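(* Let $A$ be a unital $C^*$-algebra without bounded traces. Let $f$ be a nonconstant polynomial in (finitely many) noncommuting variables with coefficients in $\mathbb{C}$. Then there exists $N\in\mathbb{N}$ such that each element of $A$ is expressible as a linear combination of $N$ values of $f$ on $A$.
   Context: A bounded trace on $A$ is a nonzero bounded positive linear functional $\tau$ with $\tau(xy)=\tau(yx)$ for all $x,y\in A$. A polynomial is nonconstant if it has positive degree in at least one of its variables. If $f$ has $n$ variables, a value of $f$ on $A$ is an element $f(a_1,\dots,a_n)$ with $a_1,\dots,a_n\in A$ (the constant term being multiplied by the unit of $A$). *)

theory Defs
  imports "HOL-Analysis.Analysis" "HOL-Library.Poly_Mapping"
begin

text \<open>
  Unital C*-algebras, with \<open>1 \<noteq> 0\<close> as always for the unital algebra classes of the library.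
  Complex scalar multiplication extends the real one of \<^class>\<open>real_vector\<close>, so
  \<open>scaleC 1 x = x\<close> need not be assumed. The axiom \<open>norm 1 = 1\<close> inherited from
  \<^class>\<open>real_normed_algebra_1\<close> is a consequence of the C*-identity and \<open>1 \<noteq> 0\<close>.
\<close>

class unital_cstar_algebra = real_normed_algebra_1 + banach +
  fixes scaleC :: "complex \<Rightarrow> 'a \<Rightarrow> 'a"  (infixr \<open>*\<^sub>C\<close> 75)
    and star :: "'a \<Rightarrow> 'a"
  assumes scaleC_add_right: "c *\<^sub>C (x + y) = c *\<^sub>C x + c *\<^sub>C y"
    and scaleC_add_left: "(c + d) *\<^sub>C x = c *\<^sub>C x + d *\<^sub>C x"
    and scaleC_scaleC: "c *\<^sub>C d *\<^sub>C x = (c * d) *\<^sub>C x"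
    and scaleC_of_real: "complex_of_real r *\<^sub>C x = r *\<^sub>R x"
    and mult_scaleC_left: "c *\<^sub>C x * y = c *\<^sub>C (x * y)"
    and mult_scaleC_right: "x * c *\<^sub>C y = c *\<^sub>C (x * y)"
    and norm_scaleC: "norm (c *\<^sub>C x) = cmod c * norm x"
    and star_add: "star (x + y) = star x + star y"
    and star_scaleC: "star (c *\<^sub>C x) = cnj c *\<^sub>C star x"
    and star_mult: "star (x * y) = star y * star x"
    and star_star: "star (star x) = x"
    and cstar_identity: "norm (star x * x) = (norm x)\<^sup>2"

definition bounded_trace :: "('a::unital_cstar_algebra \<Rightarrow> complex) \<Rightarrow> bool" where
  "bounded_trace \<tau> \<longleftrightarrow>
     (\<exists>x. \<tau> x \<noteq> 0) \<and>
     bounded_linear \<tau> \<and> (\<forall>c x. \<tau> (c *\<^sub>C x) = c * \<tau> x) \<and>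
     (\<forall>x. \<tau> (star x * x) \<in> \<real>\<^sub>\<ge>\<^sub>0) \<and>
     (\<forall>x y. \<tau> (x * y) = \<tau> (y * x))"

text \<open>
  The free algebra over the complex numbers on a set \<open>'v\<close> of noncommuting variables has the words
  over \<open>'v\<close> as a basis; a polynomial is given by its finitely many nonzero coefficients.
  The empty word is the constant monomial.
\<close>

type_synonym 'v ncpoly = "'v list \<Rightarrow>\<^sub>0 complex"

definition ncdegree_in :: "'v \<Rightarrow> 'v ncpoly \<Rightarrow> nat" where
  "ncdegree_in v f = Max (insert 0 ((\<lambda>w. count_list w v) ` Poly_Mapping.keys f))"

definition nonconstant :: "'v ncpoly \<Rightarrow> bool" where
  "nonconstant f \<longleftrightarrow> (\<exists>v. ncdegree_in v f > 0)"

definition nceval :: "'v ncpoly \<Rightarrow> ('v \<Rightarrow> 'a::unital_cstar_algebra) \<Rightarrow> 'a" where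
  "nceval f a = (\<Sum>w\<in>Poly_Mapping.keys f. Poly_Mapping.lookup f w *\<^sub>C prod_list (map a w))"

end

theory Submission
  imports Defs "HOL-Complex_Analysis.Complex_Analysis"
begin

text \<open>
  The theorem rests on two facts about an algebra \<open>A\<close> without bounded traces, and on a link between them.

  First, every element of \<open>A\<close> is a sum of a bounded number of commutators, a theorem of Pop
  (\<open>all_sums_of_commutators\<close>). By Hahn--Banach, a positive trace exists as soon as \<open>1\<close> has distance
  at least \<open>1\<close> from the real span of the self-commutators \<open>x\<^sup>* x - x x\<^sup>*\<close>. Without traces, some finite
  sum of self-commutators therefore has distance less than \<open>1\<close> from \<open>1\<close>. Adding one more self-adjoint element,
  a square root, to the family gives \<open>y\<^sub>1, \<dots>, y\<^sub>n\<close> with \<open>\<Sum> y\<^sub>i\<^sup>* y\<^sub>i = c\<close> and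
  \<open>\<parallel>\<Sum> y\<^sub>i y\<^sub>i\<^sup>*\<parallel> < c\<close>. The map \<open>a \<mapsto> \<Sum> y\<^sub>i a y\<^sub>i\<^sup>*\<close> then has norm less than \<open>c\<close> on self-adjoint
  elements, so \<open>c a - \<Sum> y\<^sub>i a y\<^sub>i\<^sup>* = x\<close> can be solved for \<open>a\<close>, and the left side is
  \<open>\<Sum> [y\<^sub>i\<^sup>*, y\<^sub>i a]\<close>. The norm bound needs that \<open>y\<^sup>* y\<close> is always positive, which is developed here
  from square roots given by the binomial series.

  Second, let \<open>g\<close> be a nonzero multilinear polynomial of positive degree, its variables numbered so that
  the monomial with increasing indices occurs. The commutators \<open>[g(x), g(y)]\<close> generate \<open>A\<close> as a
  two-sided ideal (\<open>commutators_of_multilinear_values_generate\<close>). Otherwise they all lie in some maximal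
  left ideal \<open>M\<close> and act as zero on the simple module \<open>A/M\<close>. Its endomorphisms are scalars by
  Gelfand--Mazur. If \<open>A/M\<close> is finite-dimensional, the matrix trace of the action is a nonzero functional
  that kills commutators and does not kill \<open>1\<close>, against the first fact. If it is infinite-dimensional,
  Jacobson density provides elements that move along a long chain of independent vectors, and on these
  only one monomial of \<open>g\<close> survives, so \<open>[g(x), g(y)]\<close> does not vanish.

  The link is that the linear span \<open>L\<close> of the values of \<open>g\<close> is a Lie ideal. For every Lie ideal, \<open>[A, J]\<close>
  is contained in \<open>L\<close>, where \<open>J\<close> is the two-sided ideal generated by \<open>[L, L]\<close>; here \<open>J = A\<close>. All the
  identities involved have a fixed number of terms, so each commutator, and hence each element, is a
  combination of a bounded number of values of \<open>g\<close> (\<open>combination_of_multilinear_values\<close>).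

  Finally a nonconstant \<open>f\<close> is replaced by a linearization \<open>g\<close> of its part of highest degree. By
  inclusion--exclusion, each value of \<open>g\<close> is, up to sign, an alternating sum of \<open>2\<^sup>d\<close> values of \<open>f\<close>, where \<open>d\<close> is
  the degree (\<open>linearization\<close>).
\<close>

section \<open>Scalars and the involution\<close>

lemma scaleC_zero_left [simp]: "0 *\<^sub>C (x::'a::unital_cstar_algebra) = 0"
  using scaleC_of_real[of 0 x] by simp

lemma scaleC_zero_right [simp]: "c *\<^sub>C (0::'a::unital_cstar_algebra) = 0"
  using scaleC_add_right[of c 0 "0::'a"] by simp

lemma scaleC_one [simp]: "1 *\<^sub>C (x::'a::unital_cstar_algebra) = x"
  using scaleC_of_real[of 1 x] by simp

lemma scaleC_minus_left [simp]: "(- c) *\<^sub>C (x::'a::unital_cstar_algebra) = - (c *\<^sub>C x)"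
  using scaleC_add_left[of c "-c" x] by (simp add: eq_neg_iff_add_eq_0 add.commute)

lemma scaleC_minus_right [simp]: "c *\<^sub>C (- x::'a::unital_cstar_algebra) = - (c *\<^sub>C x)"
  using scaleC_add_right[of c x "-x"] by (simp add: eq_neg_iff_add_eq_0 add.commute)

lemma scaleC_diff_right: "c *\<^sub>C (x - y::'a::unital_cstar_algebra) = c *\<^sub>C x - c *\<^sub>C y"
  using scaleC_add_right[of c x "-y"] by simp

lemma scaleC_diff_left: "(c - d) *\<^sub>C (x::'a::unital_cstar_algebra) = c *\<^sub>C x - d *\<^sub>C x"
  using scaleC_add_left[of c "-d" x] by simp

lemma scaleC_sum_right: "c *\<^sub>C (\<Sum>i\<in>I. x i :: 'a::unital_cstar_algebra) = (\<Sum>i\<in>I. c *\<^sub>C x i)"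
  by (induction I rule: infinite_finite_induct) (auto simp: scaleC_add_right)

lemma scaleC_sum_left: "(\<Sum>i\<in>I. c i) *\<^sub>C (x :: 'a::unital_cstar_algebra) = (\<Sum>i\<in>I. c i *\<^sub>C x)"
  by (induction I rule: infinite_finite_induct) (auto simp: scaleC_add_left)

lemma scaleC_scaleR: "c *\<^sub>C r *\<^sub>R (x :: 'a::unital_cstar_algebra) = r *\<^sub>R c *\<^sub>C x"
  by (simp flip: scaleC_of_real add: scaleC_scaleC mult.commute)

lemma of_real_mult_scaleR:
  "of_real r * x = r *\<^sub>R x" "x * of_real r = r *\<^sub>R (x :: 'a::real_algebra_1)"
  by (simp_all add: of_real_def)

lemma star_zero [simp]: "star (0::'a::unital_cstar_algebra) = 0"
  using star_add[of 0 "0::'a"] by simp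

lemma star_minus [simp]: "star (- x::'a::unital_cstar_algebra) = - star x"
  using star_add[of x "-x"] by (simp add: eq_neg_iff_add_eq_0 add.commute)

lemma star_diff: "star (x - y::'a::unital_cstar_algebra) = star x - star y"
  using star_add[of x "-y"] by simp

lemma star_one [simp]: "star (1::'a::unital_cstar_algebra) = 1"
  by (metis mult.right_neutral mult.left_neutral star_mult star_star)

lemma star_scaleR [simp]: "star (r *\<^sub>R x::'a::unital_cstar_algebra) = r *\<^sub>R star x"
  using star_scaleC[of "of_real r" x] by (simp add: scaleC_of_real)

lemma star_of_real [simp]: "star (of_real r::'a::unital_cstar_algebra) = of_real r"
  by (simp add: of_real_def)

lemma star_power: "star (x ^ n :: 'a::unital_cstar_algebra) = star x ^ n"
  by (induction n) (auto simp: star_mult power_commutes)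

lemma norm_star [simp]: "norm (star x) = norm (x::'a::unital_cstar_algebra)"
proof -
  have le: "norm x \<le> norm (star x)" for x :: 'a
  proof (cases "x = 0")
    case False
    have "norm x * norm x = norm (star x * x)"
      by (simp add: cstar_identity power2_eq_square)
    also have "\<dots> \<le> norm (star x) * norm x" by (rule norm_mult_ineq)
    finally show ?thesis using False by simp
  qed simp
  show ?thesis using le[of x] le[of "star x"] by (simp add: star_star)
qed

lemma norm_square_self_adjoint:
  fixes h :: "'a::unital_cstar_algebra"
  assumes "star h = h"
  shows "norm (h * h) = (norm h)\<^sup>2"
  using cstar_identity[of h] assms by simp

lemma bounded_linear_star: "bounded_linear (star :: 'a::unital_cstar_algebra \<Rightarrow> 'a)"
  by (rule bounded_linear_intro[where K = 1]) (auto simp: star_add)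

definition real_part :: "'a::unital_cstar_algebra \<Rightarrow> 'a" where
  "real_part x = (1/2) *\<^sub>R (x + star x)"

text \<open>
  The second summand of \<open>x = real_part x + \<i> *\<^sub>C imag_part x\<close>, so that both parts are self-adjoint.
\<close>

definition imag_part :: "'a::unital_cstar_algebra \<Rightarrow> 'a" where
  "imag_part x = real_part (- \<i> *\<^sub>C x)"

lemma star_real_part [simp]: "star (real_part x) = real_part x"
  by (simp add: real_part_def star_add star_star add.commute)

lemma star_imag_part [simp]: "star (imag_part x) = imag_part x"
  by (simp add: imag_part_def)

lemma real_imag_parts: "real_part x + \<i> *\<^sub>C imag_part x = x"
proof -
  have "\<i> *\<^sub>C imag_part x = (1/2) *\<^sub>R (x - star x)"
    by (simp add: imag_part_def real_part_def scaleC_scaleR scaleC_add_right scaleC_scaleC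
        star_scaleC scaleC_diff_right)
  then have "real_part x + \<i> *\<^sub>C imag_part x = (1/2) *\<^sub>R (x + x)"
    by (simp add: real_part_def flip: scaleR_add_right)
  then show ?thesis by (simp flip: scaleR_2)
qed

section \<open>Square roots\<close>

text \<open>
  The coefficients of the Taylor series of \<open>sqrt (1 - z)\<close> at \<open>0\<close>.
\<close>

definition sqrt_coeff :: "nat \<Rightarrow> real" where
  "sqrt_coeff n = (-1) ^ n * ((1/2) gchoose n)"

lemma sqrt_coeff_0 [simp]: "sqrt_coeff 0 = 1"
  by (simp add: sqrt_coeff_def)

lemma sqrt_coeff_Suc: "sqrt_coeff (Suc n) = sqrt_coeff n * ((real n - 1/2) / (real n + 1))"
proof -
  have "((1/2::real) gchoose Suc n) = ((1/2) gchoose n) * (1/2 - real n) / (real n + 1)"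
    using gbinomial_mult_1[of "1/2::real" n] by (simp add: field_simps)
  then show ?thesis unfolding sqrt_coeff_def by simp (simp add: algebra_simps minus_divide_left)
qed

lemma sqrt_coeff_Suc_nonpos: "sqrt_coeff (Suc n) \<le> 0"
proof (induction n)
  case (Suc n)
  then show ?case
    by (subst sqrt_coeff_Suc) (intro mult_nonpos_nonneg, auto)
qed (simp add: sqrt_coeff_Suc)

text \<open>
  All coefficients but the first are nonpositive, so a lower bound for the partial sums is what
  makes the series converge absolutely on the closed unit disc, boundary included. The partial sums
  have a closed form, a binomial coefficient of \<open>- 1/2\<close> up to sign.
\<close>

lemma sum_sqrt_coeff_nonneg: "0 \<le> (\<Sum>n\<le>N. sqrt_coeff n)"
proof -
  have "(\<Sum>n\<le>N. sqrt_coeff n) = (-1) ^ N * ((1/2 - 1 :: real) gchoose N)"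
    unfolding sqrt_coeff_def using gbinomial_sum_lower_neg[of "1/2::real" N]
    by (simp add: mult.commute)
  also have "\<dots> = (\<Prod>i<N. (real i + 1/2)) / fact N"
  proof -
    have "(\<Prod>i<N. (1/2 - 1 :: real) - real i) = (\<Prod>i<N. - 1 * (real i + 1/2))"
      by (rule prod.cong) auto
    also have "\<dots> = (-1) ^ N * (\<Prod>i<N. real i + 1/2)"
      by (subst prod.distrib) simp
    finally show ?thesis by (simp add: gbinomial_prod_rev atLeast0LessThan flip: power_mult_distrib mult.assoc)
  qed
  finally show ?thesis by (simp add: prod_nonneg)
qed

text \<open>
  Vandermonde's identity with \<open>1/2 + 1/2 = 1\<close>: as a formal power series, the square of the series
  is \<open>1 - z\<close>.
\<close>

lemma sqrt_coeff_convolution: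
  "(\<Sum>i\<le>n. sqrt_coeff i * sqrt_coeff (n - i)) = (if n = 0 then 1 else if n = 1 then -1 else 0)"
proof -
  have "(\<Sum>i\<le>n. sqrt_coeff i * sqrt_coeff (n - i))
        = (-1) ^ n * (\<Sum>i\<le>n. ((1/2) gchoose i) * ((1/2) gchoose (n - i)))"
    unfolding sum_distrib_left sqrt_coeff_def
    by (rule sum.cong) (auto simp flip: power_add simp: mult_ac) 
  also have "\<dots> = (-1) ^ n * ((1::real) gchoose n)"
    using gbinomial_Vandermonde[of "1/2::real" "1/2" n] by (simp add: atMost_atLeast0)
  also have "\<dots> = (if n = 0 then 1 else if n = 1 then -1 else 0)"
    using binomial_gbinomial[of 1 n, where 'a = real] 
    by (auto simp: binomial_eq_0 simp del: binomial_gbinomial)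
  finally show ?thesis .
qed

lemma summable_abs_sqrt_coeff: "summable (\<lambda>n. \<bar>sqrt_coeff n\<bar>)"
  and sum_abs_sqrt_coeff: "suminf (\<lambda>n. \<bar>sqrt_coeff (Suc n)\<bar>) \<le> 1"
proof -
  have bd: "(\<Sum>n<N. \<bar>sqrt_coeff (Suc n)\<bar>) \<le> 1" for N
  proof -
    have "(\<Sum>n<N. \<bar>sqrt_coeff (Suc n)\<bar>) = - (\<Sum>n<N. sqrt_coeff (Suc n))"
      using sqrt_coeff_Suc_nonpos by (simp add: abs_of_nonpos sum_negf)
    also have "\<dots> = 1 - (\<Sum>n\<le>N. sqrt_coeff n)"
      using sum.lessThan_Suc_shift[of sqrt_coeff N] by (simp add: lessThan_Suc_atMost)
    also have "\<dots> \<le> 1" using sum_sqrt_coeff_nonneg[of N] by simp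
    finally show ?thesis .
  qed
  have s: "summable (\<lambda>n. \<bar>sqrt_coeff (Suc n)\<bar>)"
    by (rule summableI_nonneg_bounded[of _ 1]) (use bd in auto)
  then show "summable (\<lambda>n. \<bar>sqrt_coeff n\<bar>)" by (subst (asm) summable_Suc_iff)
  show "suminf (\<lambda>n. \<bar>sqrt_coeff (Suc n)\<bar>) \<le> 1" using bd s by (simp add: suminf_le_const)
qed

text \<open>
  The root is the binomial series, and \<open>r\<close> is minus its nonconstant part. Being a limit of
  polynomials in \<open>z\<close> with real coefficients, \<open>r\<close> is self-adjoint and commutes with whatever commutes with
  \<open>z\<close>. The bound on \<open>r\<close> shows that the root is itself positive.
\<close>

lemma sqrt_one_minus:
  fixes z :: "'a::unital_cstar_algebra"
  assumes z: "norm z \<le> 1" "star z = z"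
  obtains r where "norm r \<le> 1" "star r = r" "(1 - r) * (1 - r) = 1 - z"
    "\<And>g. g * z = z * g \<Longrightarrow> g * r = r * g"
proof -
  define b where "b n = sqrt_coeff n *\<^sub>R z ^ n" for n
  have nz: "norm (z ^ n) \<le> 1" for n
    using norm_power_ineq[of z n] power_le_one[OF norm_ge_zero z(1), of n] by linarith
  have nb: "norm (b n) \<le> \<bar>sqrt_coeff n\<bar>" for n
    unfolding b_def using nz[of n] by (simp add: mult_left_le)
  have sb: "summable (\<lambda>n. norm (b n))"
    by (rule summable_comparison_test'[OF summable_abs_sqrt_coeff, of 0]) (use nb in auto)
  have sb': "summable b" by (rule summable_norm_cancel[OF sb])
  define r where "r = - suminf (\<lambda>n. b (Suc n))"
  have b0: "b 0 = 1" by (simp add: b_def)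
  have r: "suminf b = 1 - r"
    using suminf_split_head[OF sb'] by (simp add: r_def b0)
  have sSuc: "summable (\<lambda>n. norm (b (Suc n)))" using sb by (subst summable_Suc_iff)
  show ?thesis
  proof
    have "norm r \<le> suminf (\<lambda>n. norm (b (Suc n)))"
      unfolding r_def using summable_norm[OF sSuc] by simp
    also have "\<dots> \<le> suminf (\<lambda>n. \<bar>sqrt_coeff (Suc n)\<bar>)"
      by (rule suminf_le) (use nb sSuc summable_Suc_iff[of "\<lambda>n. \<bar>sqrt_coeff n\<bar>"] summable_abs_sqrt_coeff in auto)
    also have "\<dots> \<le> 1" by (rule sum_abs_sqrt_coeff)
    finally show "norm r \<le> 1" .
    have "star (suminf b) = suminf (\<lambda>n. star (b n))"
      by (rule bounded_linear.suminf[OF bounded_linear_star sb'])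
    also have "\<dots> = suminf b" by (simp add: b_def[abs_def] star_power z)
    finally show "star r = r" by (simp add: r star_diff)
    have "(\<lambda>n. \<Sum>i\<le>n. b i * b (n - i)) sums ((1 - r) * (1 - r))"
      using Cauchy_product_sums[OF sb sb] by (simp add: r)
    moreover have "(\<Sum>i\<le>n. b i * b (n - i))
        = (if n = 0 then 1 else if n = 1 then -1 else 0) *\<^sub>R z ^ n" for n
    proof -
      have "(\<Sum>i\<le>n. b i * b (n - i)) = (\<Sum>i\<le>n. sqrt_coeff i * sqrt_coeff (n - i)) *\<^sub>R z ^ n"
        unfolding scaleR_sum_left b_def
        by (rule sum.cong) (auto simp: mult.commute simp flip: power_add)
      then show ?thesis by (simp only: sqrt_coeff_convolution)
    qed
    moreover have "(\<lambda>n. (if n = 0 then 1 else if n = 1 then -1 else 0) *\<^sub>R z ^ n) sums (1 - z)"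
      using sums_finite[of "{0, 1}" "\<lambda>n. (if n = 0 then 1 else if n = 1 then -1 else (0::real)) *\<^sub>R z ^ n"]
      by simp
    ultimately show "(1 - r) * (1 - r) = 1 - z"
      by (simp add: sums_unique2)
    fix g assume g: "g * z = z * g"
    have "g * z ^ n = z ^ n * g" for n
      by (induction n) (auto simp: g mult.assoc, metis g mult.assoc)
    then have "g * b n = b n * g" for n by (simp add: b_def)
    then have "g * suminf b = suminf b * g"
      using suminf_mult[OF sb', of g] suminf_mult2[OF sb', of g] by simp
    then show "g * r = r * g" by (simp add: r algebra_simps)
  qed
qed

section \<open>Positive elements\<close>

text \<open>
  Positivity is expressed by the norm: for self-adjoint \<open>h\<close> the condition says that the spectrum of \<open>h\<close>
  lies in \<open>{0..2 * t}\<close>. In this form it is stable under sums by the triangle inequality, and it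
  gives the argument \<open>1 - h / t\<close> of norm at most \<open>1\<close> to which the square root series applies.
\<close>

definition pos_elem :: "'a::unital_cstar_algebra \<Rightarrow> bool" where
  "pos_elem h \<longleftrightarrow> star h = h \<and> (\<exists>t\<ge>0. norm (of_real t - h) \<le> t)"

lemma pos_elem_self_adjoint: "pos_elem h \<Longrightarrow> star h = h"
  by (simp add: pos_elem_def)

lemma pos_elem_sqrt:
  fixes h :: "'a::unital_cstar_algebra"
  assumes "pos_elem h"
  obtains s where "pos_elem s" "s * s = h" "\<forall>g. g * h = h * g \<longrightarrow> g * s = s * g"
proof -
  obtain t where h: "star h = h" and t: "t \<ge> 0" "norm (of_real t - h) \<le> t"
    using assms by (auto simp: pos_elem_def)
  show ?thesis
  proof (cases "t = 0")
    case True
    with t have "h = 0" by simp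
    then show ?thesis using that[of 0] by (auto simp: pos_elem_def intro: exI[of _ 0])
  next
    case False
    with t have t0: "t > 0" by simp
    define z where "z = 1 - (1/t) *\<^sub>R h"
    have tz: "t *\<^sub>R z = of_real t - h" using t0 by (simp add: z_def scaleR_diff_right of_real_def)
    have "t * norm z \<le> t * 1" using arg_cong[OF tz, of norm] t0 t(2) by simp
    then have nz: "norm z \<le> 1" using t0 by simp
    have sz: "star z = z" by (simp add: z_def star_diff h)
    obtain r where r: "norm r \<le> 1" "star r = r" "(1 - r) * (1 - r) = 1 - z"
      and comm: "\<forall>g. g * z = z * g \<longrightarrow> g * r = r * g"
      using sqrt_one_minus[OF nz sz] by metis
    show ?thesis
    proof
      have "norm (of_real (sqrt t) - sqrt t *\<^sub>R (1 - r)) = sqrt t * norm r"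
        using t0 by (simp add: of_real_def scaleR_diff_right)
      also have "\<dots> \<le> sqrt t" using r(1) t0 by (simp add: mult_left_le)
      finally show "pos_elem (sqrt t *\<^sub>R (1 - r))"
        using t0 r(2) by (auto simp: pos_elem_def star_diff intro!: exI[of _ "sqrt t"])
      show "sqrt t *\<^sub>R (1 - r) * sqrt t *\<^sub>R (1 - r) = h"
        using t0 by (simp add: r(3) z_def)
      show "\<forall>g. g * h = h * g \<longrightarrow> g * sqrt t *\<^sub>R (1 - r) = sqrt t *\<^sub>R (1 - r) * g"
      proof (intro allI impI)
        fix g assume "g * h = h * g"
        then have "g * z = z * g" by (simp add: z_def algebra_simps)
        with comm have "g * r = r * g" by blast
        then show "g * sqrt t *\<^sub>R (1 - r) = sqrt t *\<^sub>R (1 - r) * g"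
          by (simp add: algebra_simps)
      qed
    qed
  qed
qed

text \<open>
  The element \<open>s + \<i> t\<close> is \<open>c\<close> times a unitary, and \<open>s\<close> is its real part.
\<close>

lemma norm_le_of_squares_sum:
  fixes s t :: "'a::unital_cstar_algebra"
  assumes s: "star s = s" and t: "star t = t" and st: "s * t = t * s"
    and sum: "s * s + t * t = of_real (c\<^sup>2)" and c: "c \<ge> 0"
  shows "norm s \<le> c"
proof -
  define u where "u = s + \<i> *\<^sub>C t"
  have su: "star u = s - \<i> *\<^sub>C t" by (simp add: u_def star_add star_scaleC s t)
  have "star u * u = s * s + t * t"
    unfolding su unfolding u_def by (simp add: distrib_left left_diff_distrib mult_scaleC_left mult_scaleC_right
        scaleC_scaleC st scaleC_add_right scaleC_diff_right)
  then have "(norm u)\<^sup>2 = norm (of_real (c\<^sup>2) :: 'a)"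
    using cstar_identity[of u] by (simp only: sum)
  then have "(norm u)\<^sup>2 = c\<^sup>2" by (simp only: norm_of_real) simp
  then have nu: "norm u = c" using c by (simp add: power2_eq_iff_nonneg)
  have "2 *\<^sub>R s = u + star u" unfolding su unfolding u_def by (simp add: scaleR_2)
  then have "2 * norm s = norm (u + star u)" by (metis norm_scaleR abs_numeral)
  also have "\<dots> \<le> c + c" using norm_triangle_ineq[of u "star u"] nu by simp
  finally show ?thesis by simp
qed

text \<open>
  The number \<open>t\<close> is large enough for \<open>t - s\<^sup>2\<close> to have a square root \<open>q\<close> that commutes with \<open>s\<close>, and
  \<open>q\<^sup>2 + s\<^sup>2 = t\<close> bounds the norm of \<open>q\<close>.
\<close>

lemma norm_diff_square_le:
  fixes s :: "'a::unital_cstar_algebra"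
  assumes s: "star s = s" and t: "(norm s)\<^sup>2 \<le> t"
  shows "norm (of_real t - s * s) \<le> t"
proof (cases "t = 0")
  case True
  then show ?thesis using t by simp
next
  case False
  then have t0: "t > 0" using t zero_le_power2[of "norm s"] by linarith
  define z where "z = (1/t) *\<^sub>R (s * s)"
  have nz: "norm z \<le> 1" using t t0 by (simp add: z_def norm_square_self_adjoint s)
  have sz: "star z = z" by (simp add: z_def star_mult s)
  obtain r where r: "norm r \<le> 1" "star r = r" "(1 - r) * (1 - r) = 1 - z"
    and comm: "\<forall>g. g * z = z * g \<longrightarrow> g * r = r * g"
    using sqrt_one_minus[OF nz sz] by metis
  define q where "q = sqrt t *\<^sub>R (1 - r)"
  have q: "star q = q" by (simp add: q_def star_diff r)
  have qq: "q * q = of_real t - s * s"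
    using t0 by (simp add: q_def r(3)) (simp add: z_def scaleR_diff_right of_real_def)
  have "s * z = z * s" by (simp add: z_def mult.assoc)
  with comm have "s * r = r * s" by blast
  then have "q * s = s * q" by (simp add: q_def algebra_simps)
  moreover have "q * q + s * s = of_real ((sqrt t)\<^sup>2)" using t0 by (simp add: qq)
  ultimately have nq: "norm q \<le> sqrt t"
    using norm_le_of_squares_sum[OF q s, of "sqrt t"] t0 by simp
  have "(norm q)\<^sup>2 \<le> t"
    using power_mono[OF nq norm_ge_zero, of 2] t0 by simp
  then show ?thesis by (metis qq norm_square_self_adjoint q)
qed

lemma pos_elem_square: "star s = s \<Longrightarrow> pos_elem (s * s)"
  unfolding pos_elem_def using norm_diff_square_le[of s "(norm s)\<^sup>2"]
  by (auto simp: star_mult intro!: exI[of _ "(norm s)\<^sup>2"])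

text \<open>
  The number \<open>t\<close> in the definition of positivity may be any upper bound of the norm of \<open>h\<close>.
\<close>

lemma pos_elem_norm_diff_le:
  assumes "pos_elem h" "norm h \<le> t"
  shows "norm (of_real t - h) \<le> t"
proof -
  obtain s where s: "pos_elem s" "s * s = h" using pos_elem_sqrt[OF assms(1)] by metis
  then show ?thesis
    using norm_diff_square_le[OF pos_elem_self_adjoint[OF s(1)]] norm_square_self_adjoint[OF pos_elem_self_adjoint[OF s(1)]] assms(2)
    by metis
qed

lemma pos_elem_add:
  assumes "pos_elem a" "pos_elem b"
  shows "pos_elem (a + b)"
proof -
  obtain t u where t: "t \<ge> 0" "norm (of_real t - a) \<le> t" and u: "u \<ge> 0" "norm (of_real u - b) \<le> u"
    using assms by (auto simp: pos_elem_def)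
  have "norm (of_real (t + u) - (a + b)) \<le> t + u"
    using norm_triangle_ineq[of "of_real t - a" "of_real u - b"] t u by (simp add: algebra_simps)
  then show ?thesis using assms t u
    by (auto simp: pos_elem_def star_add intro!: exI[of _ "t + u"])
qed

lemma pos_elem_scaleR:
  assumes "pos_elem a" "r \<ge> 0"
  shows "pos_elem (r *\<^sub>R a)"
proof -
  obtain t where t: "t \<ge> 0" "norm (of_real t - a) \<le> t" using assms by (auto simp: pos_elem_def)
  have "of_real (r * t) - r *\<^sub>R a = r *\<^sub>R (of_real t - a)"
    by (simp add: scaleR_diff_right of_real_def)
  then have "norm (of_real (r * t) - r *\<^sub>R a) \<le> r * t"
    using assms(2) t(2) by (simp only: norm_scaleR abs_of_nonneg) (simp add: mult_left_mono)
  then show ?thesis using assms t by (auto simp: pos_elem_def intro!: exI[of _ "r * t"])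
qed

lemma pos_elem_of_real_diff:
  assumes "star h = h" "norm h \<le> t"
  shows "pos_elem (of_real t - h)"
  using assms order_trans[OF norm_ge_zero assms(2)]
  by (auto simp: pos_elem_def star_diff intro!: exI[of _ t])

text \<open>
  The order interval between \<open>- t\<close> and \<open>t\<close> lies in the ball of radius \<open>t\<close>: the product of the square
  roots \<open>s\<close> of \<open>t - h\<close> and \<open>u\<close> of \<open>t + h\<close> satisfies \<open>(s u)\<^sup>2 + h\<^sup>2 = t\<^sup>2\<close>.
\<close>

lemma norm_le_if_positive:
  fixes h :: "'a::unital_cstar_algebra"
  assumes m: "pos_elem (of_real t - h)" and p: "pos_elem (of_real t + h)"
  shows "norm h \<le> t"
proof -
  have h: "star h = h" using pos_elem_self_adjoint[OF m] by (simp add: star_diff)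
  have "pos_elem (of_real (2 * t) :: 'a)"
    using pos_elem_add[OF m p] by (simp flip: of_real_add)
  then obtain r where r: "norm (of_real r - of_real (2 * t) :: 'a) \<le> r"
    by (auto simp: pos_elem_def)
  then have "\<bar>r - 2 * t\<bar> \<le> r" by (metis norm_of_real of_real_diff)
  then have t: "t \<ge> 0" by linarith
  obtain s where s: "pos_elem s" "s * s = of_real t - h"
    and cs: "\<forall>g. g * (of_real t - h) = (of_real t - h) * g \<longrightarrow> g * s = s * g"
    by (rule pos_elem_sqrt[OF m])
  obtain u where u: "pos_elem u" "u * u = of_real t + h"
    and cu: "\<forall>g. g * (of_real t + h) = (of_real t + h) * g \<longrightarrow> g * u = u * g"
    by (rule pos_elem_sqrt[OF p])
  have hs: "h * s = s * h" by (rule cs[rule_format]) (simp add: algebra_simps of_real_mult_scaleR)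
  have hu: "h * u = u * h" by (rule cu[rule_format]) (simp add: algebra_simps of_real_mult_scaleR)
  have su: "s * u = u * s" by (rule cu[rule_format]) (simp add: algebra_simps of_real_mult_scaleR hs)
  show ?thesis
  proof (rule norm_le_of_squares_sum[OF h _ _ _ t])
    show "star (s * u) = s * u"
      by (simp add: star_mult pos_elem_self_adjoint s(1) u(1) su)
    show "h * (s * u) = s * u * h"
      by (metis hs hu mult.assoc)
    have "(s * u) * (s * u) = (s * s) * (u * u)" by (metis su mult.assoc)
    also have "\<dots> = of_real (t\<^sup>2) - h * h"
      unfolding s u by (simp add: algebra_simps of_real_mult_scaleR power2_eq_square)
    finally show "h * h + s * u * (s * u) = of_real (t\<^sup>2)" by simp
  qed
qed

lemma norm_positive_mono:
  fixes a b :: "'a::unital_cstar_algebra"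
  assumes "pos_elem a" "pos_elem b"
  shows "norm a \<le> norm (a + b)"
proof (rule norm_le_if_positive)
  let ?c = "norm (a + b)"
  have "pos_elem (of_real ?c - (a + b))"
    by (rule pos_elem_of_real_diff) (simp_all add: pos_elem_self_adjoint pos_elem_add assms)
  from pos_elem_add[OF this assms(2)] show "pos_elem (of_real ?c - a)" by simp
  have "pos_elem (of_real ?c - (0::'a))" by (rule pos_elem_of_real_diff) auto
  with assms show "pos_elem (of_real ?c + a)" by (simp add: pos_elem_add)
qed

lemma pos_elem_conjugate_commuting:
  fixes a g :: "'a::unital_cstar_algebra"
  assumes "pos_elem a" "star g = g" "g * a = a * g"
  shows "pos_elem (g * a * g)"
proof -
  obtain s where s: "pos_elem s" "s * s = a"
    and comm: "\<forall>g. g * a = a * g \<longrightarrow> g * s = s * g"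
    by (rule pos_elem_sqrt[OF assms(1)])
  have gs: "g * s = s * g" by (rule comm[rule_format]) (rule assms(3))
  have "g * a * g = (g * s) * (s * g)" by (simp add: mult.assoc flip: s(2))
  also have "\<dots> = (g * s) * (g * s)" by (simp only: gs)
  finally have "g * a * g = (g * s) * (g * s)" .
  moreover have "star (g * s) = g * s"
    by (simp add: star_mult pos_elem_self_adjoint s(1) assms(2) gs)
  ultimately show ?thesis using pos_elem_square by metis
qed

text \<open>
  Put \<open>p = - z\<^sup>* z\<close>, \<open>q = z z\<^sup>*\<close> and \<open>t = \<parallel>z\<parallel>\<^sup>2\<close>, the norm of both. If \<open>p\<close> is positive then so is \<open>q\<close>,
  because \<open>z\<^sup>* z + z z\<^sup>*\<close> is a sum of squares. The relation \<open>z (t + p) = (t - q) z\<close> shows that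
  multiplying by \<open>t + p\<close> does not stretch \<open>z\<close> by more than \<open>t\<close>. As \<open>p\<close> is positive of norm \<open>t\<close>, the element
  \<open>(t + p) p (t + p)\<close> is too large for this unless \<open>t = 0\<close>.
\<close>

lemma zero_if_negative_star_mult:
  fixes z :: "'a::unital_cstar_algebra"
  assumes neg: "pos_elem (- (star z * z))"
  shows "z = 0"
proof -
  define p where "p = - (star z * z)"
  define q where "q = z * star z"
  define t where "t = (norm z)\<^sup>2"
  have p: "pos_elem p" "star p = p" using neg by (simp_all add: p_def star_mult star_star)
  have t0: "t \<ge> 0" by (simp add: t_def)
  have np: "norm p = t" by (simp add: p_def t_def cstar_identity)
  have nq: "norm q = t" using cstar_identity[of "star z"] by (simp add: q_def t_def star_star)
  have qpos: "pos_elem q"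
  proof -
    define a b where "a = real_part z" and "b = imag_part z"
    have ab: "star a = a" "star b = b" by (simp_all add: a_def b_def)
    have z: "z = a + \<i> *\<^sub>C b" by (simp add: a_def b_def real_imag_parts)
    have sz: "star z = a - \<i> *\<^sub>C b" by (simp add: z star_add star_scaleC ab)
    have "q = 2 *\<^sub>R (a * a) + 2 *\<^sub>R (b * b) + p"
      unfolding p_def q_def sz unfolding z
      by (simp add: distrib_left distrib_right left_diff_distrib right_diff_distrib
          mult_scaleC_left mult_scaleC_right scaleC_scaleC scaleC_add_right scaleC_diff_right scaleR_2)
    then show ?thesis using p ab by (simp add: pos_elem_add pos_elem_scaleR pos_elem_square)
  qed
  have "z * (of_real t + p) = (of_real t - q) * z"
    by (simp add: p_def q_def algebra_simps of_real_mult_scaleR)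
  then have "norm (z * (of_real t + p)) \<le> t * norm z"
    using norm_mult_ineq[of "of_real t - q" z] pos_elem_norm_diff_le[OF qpos, of t] nq
      mult_right_mono[of "norm (of_real t - q)" t "norm z"] by simp
  then have "(norm (z * (of_real t + p)))\<^sup>2 \<le> (t * norm z)\<^sup>2"
    by (rule power_mono) simp
  moreover have "star (z * (of_real t + p)) * (z * (of_real t + p))
      = - ((of_real t + p) * p * (of_real t + p))"
    by (simp add: star_mult star_add p(2)) (simp add: p_def mult.assoc)
  ultimately have le: "norm ((of_real t + p) * p * (of_real t + p)) \<le> t\<^sup>2 * t"
    using cstar_identity[of "z * (of_real t + p)"] by (simp add: power_mult_distrib t_def)
  have "(of_real t + p) * p * (of_real t + p)
      = t *\<^sub>R t *\<^sub>R p + t *\<^sub>R (p * p) + (t *\<^sub>R (p * p) + p * p * p)"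
    by (simp only: distrib_left distrib_right of_real_mult_scaleR mult_scaleR_left mult_scaleR_right
        scaleR_add_right mult.assoc add.assoc)
  also have "\<dots> = (2 * t) *\<^sub>R (p * p) + ((t\<^sup>2) *\<^sub>R p + p * p * p)"
    by (simp only: mult_2 scaleR_add_left scaleR_scaleR power2_eq_square add_ac)
  finally have split: "(of_real t + p) * p * (of_real t + p)
      = (2 * t) *\<^sub>R (p * p) + ((t\<^sup>2) *\<^sub>R p + p * p * p)" .
  have "norm ((2 * t) *\<^sub>R (p * p)) \<le> t\<^sup>2 * t"
    using order_trans[OF norm_positive_mono le[unfolded split]] p t0
    by (simp add: pos_elem_add pos_elem_scaleR pos_elem_square pos_elem_conjugate_commuting)
  moreover have "norm ((2 * t) *\<^sub>R (p * p)) = 2 * t * t\<^sup>2"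
    using t0 by (simp add: norm_square_self_adjoint p np)
  ultimately have "t ^ 3 \<le> 0" by (simp add: power2_eq_square power3_eq_cube)
  then have "t = 0" using t0 zero_less_power[of t 3] by linarith
  then show ?thesis by (simp add: t_def)
qed

text \<open>
  The root \<open>w\<close> of \<open>h\<^sup>2\<close> plays the part of \<open>\<bar>h\<bar>\<close>, so that \<open>v = w - h\<close> is twice the negative part of
  \<open>h = y\<^sup>* y\<close>. The element \<open>y v\<close> satisfies \<open>(y v)\<^sup>* (y v) = - v w v\<close>, which is negative, and therefore
  vanishes. It follows that \<open>v\<close> vanishes too, and \<open>h = w\<close> is positive.
\<close>

lemma pos_elem_star_mult:
  fixes y :: "'a::unital_cstar_algebra"
  shows "pos_elem (star y * y)"
proof -
  define h where "h = star y * y"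
  have h: "star h = h" by (simp add: h_def star_mult star_star)
  obtain w where w: "pos_elem w" "w * w = h * h"
    and cw: "\<forall>g. g * (h * h) = h * h * g \<longrightarrow> g * w = w * g"
    by (rule pos_elem_sqrt[OF pos_elem_square[OF h]])
  have hw: "h * w = w * h" by (rule cw[rule_format]) (simp add: mult.assoc)
  define v where "v = w - h"
  have v: "star v = v" by (simp add: v_def star_diff h pos_elem_self_adjoint w)
  have vw: "v * w = w * v" by (simp add: v_def algebra_simps hw)
  have hv: "h * v = - (w * v)" by (simp add: v_def algebra_simps hw w)
  have "star (y * v) * (y * v) = v * (h * v)" by (simp add: star_mult v h_def mult.assoc)
  also have "\<dots> = - (v * w * v)" by (simp add: hv mult.assoc)
  finally have "y * v = 0"
    using pos_elem_conjugate_commuting[OF w(1) v vw]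
    by (intro zero_if_negative_star_mult) simp
  then have hv0: "h * v = 0" by (simp add: h_def mult.assoc)
  then have "w * v = 0" using hv by simp
  then have "v * v = 0" using hv0 by (simp add: v_def left_diff_distrib)
  then have "(norm v)\<^sup>2 = 0" using norm_square_self_adjoint[OF v] by simp
  then have "v = 0" by simp
  then show ?thesis using w(1) by (simp add: v_def h_def)
qed

section \<open>A Hahn--Banach theorem\<close>

text \<open>
  The one-dimensional extension step of Hahn--Banach, with a functional dominated by the norm given by
  its graph \<open>G\<close>. The value \<open>\<alpha>\<close> at \<open>x\<close> has to lie above all \<open>s - \<parallel>y - x\<parallel>\<close> and below all
  \<open>\<parallel>y + x\<parallel> - s\<close>; the other multiples of \<open>x\<close> follow by scaling.
\<close>

lemma subspace_extend_bounded_graph: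
  fixes G :: "('a::real_normed_vector \<times> real) set"
  assumes G: "subspace G" and le: "\<And>y s. (y, s) \<in> G \<Longrightarrow> s \<le> norm y"
  obtains \<alpha> where "\<And>y s c. (y, s) \<in> G \<Longrightarrow> s + c * \<alpha> \<le> norm (y + c *\<^sub>R x)"
proof -
  define B where "B = (\<lambda>(y, s). s - norm (y - x)) ` G"
  have up: "b \<le> norm (z + x) - t" if "b \<in> B" "(z, t) \<in> G" for b z t
  proof -
    obtain y s where b: "b = s - norm (y - x)" "(y, s) \<in> G" using \<open>b \<in> B\<close> by (auto simp: B_def)
    have "s + t \<le> norm (y + z)" using subspace_add[OF G b(2) that(2)] le by simp
    also have "\<dots> \<le> norm (y - x) + norm (z + x)"
      using norm_triangle_ineq[of "y - x" "z + x"] by simp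
    finally show ?thesis by (simp add: b)
  qed
  have G0: "(0, 0) \<in> G" using subspace_0[OF G] by (simp add: zero_prod_def)
  then have ne: "B \<noteq> {}" by (auto simp: B_def)
  have bdd: "bdd_above B" using up[OF _ G0] by (auto simp: bdd_above_def)
  define \<alpha> where "\<alpha> = Sup B"
  have lower: "s - norm (y - x) \<le> \<alpha>" if "(y, s) \<in> G" for y s
    unfolding \<alpha>_def by (rule cSup_upper[OF _ bdd]) (use that in \<open>force simp: B_def\<close>)
  have upper: "\<alpha> \<le> norm (y + x) - s" if "(y, s) \<in> G" for y s
    unfolding \<alpha>_def by (rule cSup_least[OF ne]) (use up that in auto)
  show ?thesis
  proof
    fix y s and c :: real assume ys: "(y, s) \<in> G"
    have scaled: "((1/d) *\<^sub>R y, s / d) \<in> G" for d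
      using subspace_scale[OF G ys, of "1/d"] by simp
    consider "c = 0" | "c > 0" | "c < 0" using linorder_cases[of c "0::real"] by blast
    then show "s + c * \<alpha> \<le> norm (y + c *\<^sub>R x)"
    proof cases
      case 1
      then show ?thesis using le ys by simp
    next
      case 2
      have "c * (s / c + \<alpha>) \<le> c * norm ((1/c) *\<^sub>R y + x)"
        using upper[OF scaled[of c]] 2 by (intro mult_left_mono) auto
      also have "\<dots> = norm (c *\<^sub>R ((1/c) *\<^sub>R y + x))" using 2 by simp
      finally show ?thesis using 2 by (simp add: algebra_simps)
    next
      case 3
      define d where "d = - c"
      have d: "d > 0" "c = - d" using 3 by (simp_all add: d_def)
      have "d * (s / d - \<alpha>) \<le> d * norm ((1/d) *\<^sub>R y - x)"
        using lower[OF scaled[of d]] d by (intro mult_left_mono) auto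
      also have "\<dots> = norm (d *\<^sub>R ((1/d) *\<^sub>R y - x))" using d by simp
      finally show ?thesis using d by (simp add: algebra_simps)
    qed
  qed
qed

text \<open>
  Zorn's lemma is applied to the linear subspaces of \<open>'a \<times> real\<close> that extend the graph of
  \<open>k + t e \<mapsto> t\<close> and on which the second component is at most the norm of the first. This bound already makes
  such a subspace a graph, since it leaves no nonzero vector \<open>(0, t)\<close>.
\<close>

lemma norm_one_functional_vanishing_on_subspace:
  fixes S :: "'a::real_normed_vector set"
  assumes S: "subspace S" and dist: "\<And>k. k \<in> S \<Longrightarrow> 1 \<le> norm (e - k)"
  obtains \<psi> :: "'a \<Rightarrow> real"
    where "linear \<psi>" "\<And>k. k \<in> S \<Longrightarrow> \<psi> k = 0" "\<psi> e = 1" "\<And>x. \<bar>\<psi> x\<bar> \<le> norm x"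
proof -
  define G0 where "G0 = {(k + t *\<^sub>R e, t) |k t. k \<in> S}"
  define \<A> where "\<A> = {G. subspace G \<and> G0 \<subseteq> G \<and> (\<forall>(y, s)\<in>G. s \<le> norm y)}"
  have sub0: "subspace G0"
  proof (rule subspaceI)
    show "0 \<in> G0" unfolding G0_def zero_prod_def
      using subspace_0[OF S] by (intro CollectI exI[of _ 0] exI[of _ "0::'a"]) auto
    fix p q assume "p \<in> G0" "q \<in> G0"
    then obtain k t l u where "p = (k + t *\<^sub>R e, t)" "q = (l + u *\<^sub>R e, u)" "k \<in> S" "l \<in> S"
      by (auto simp: G0_def)
    then show "p + q \<in> G0" unfolding G0_def using subspace_add[OF S, of k l]
      by (intro CollectI exI[of _ "k + l"] exI[of _ "t + u"]) (auto simp: algebra_simps)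
  next
    fix p and c :: real assume "p \<in> G0"
    then obtain k t where "p = (k + t *\<^sub>R e, t)" "k \<in> S" by (auto simp: G0_def)
    then show "c *\<^sub>R p \<in> G0" unfolding G0_def using subspace_scale[OF S, of k c]
      by (intro CollectI exI[of _ "c *\<^sub>R k"] exI[of _ "c * t"]) (auto simp: algebra_simps)
  qed
  have le0: "t \<le> norm (k + t *\<^sub>R e)" if "k \<in> S" for k t
  proof (cases "t > 0")
    case True
    have "t * 1 \<le> t * norm (e - (- (1/t)) *\<^sub>R k)"
      using True dist[OF subspace_scale[OF S that, of "- (1/t)"]] by (intro mult_left_mono) auto
    also have "\<dots> = norm (t *\<^sub>R (e - (- (1/t)) *\<^sub>R k))" using True by simp
    finally show ?thesis using True by (simp add: algebra_simps)
  next
    case False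
    then show ?thesis using norm_ge_zero[of "k + t *\<^sub>R e"] by linarith
  qed
  have "G0 \<in> \<A>" using sub0 le0 by (auto simp: \<A>_def G0_def)
  moreover have "\<Union>\<C> \<in> \<A>" if ne: "\<C> \<noteq> {}" and ch: "subset.chain \<A> \<C>" for \<C>
  proof -
    have mem: "\<And>G. G \<in> \<C> \<Longrightarrow> subspace G \<and> G0 \<subseteq> G \<and> (\<forall>(y, s)\<in>G. s \<le> norm y)"
      using ch by (auto simp: subset.chain_def \<A>_def)
    have "subspace (\<Union>\<C>)"
    proof (rule subspaceI)
      show "0 \<in> \<Union>\<C>" using ne mem subspace_0 by blast
      fix p q assume "p \<in> \<Union>\<C>" "q \<in> \<Union>\<C>"
      then obtain G H where "G \<in> \<C>" "H \<in> \<C>" "p \<in> G" "q \<in> H" by auto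
      moreover from this have "G \<subseteq> H \<or> H \<subseteq> G" using ch by (auto simp: subset.chain_def)
      ultimately show "p + q \<in> \<Union>\<C>" using mem subspace_add by blast
    next
      fix p and c :: real assume "p \<in> \<Union>\<C>"
      then show "c *\<^sub>R p \<in> \<Union>\<C>" using mem subspace_scale by blast
    qed
    with mem ne show ?thesis by (fastforce simp: \<A>_def)
  qed
  ultimately obtain G where G: "G \<in> \<A>" and max: "\<And>H. H \<in> \<A> \<Longrightarrow> G \<subseteq> H \<Longrightarrow> H = G"
    using subset_Zorn_nonempty[of \<A>] by blast
  have sub: "subspace G" and G0: "G0 \<subseteq> G" and le: "\<And>y s. (y, s) \<in> G \<Longrightarrow> s \<le> norm y"
    using G by (auto simp: \<A>_def)
  have total: "\<exists>t. (x, t) \<in> G" for x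
  proof -
    obtain \<alpha> where \<alpha>: "\<And>y s c. (y, s) \<in> G \<Longrightarrow> s + c * \<alpha> \<le> norm (y + c *\<^sub>R x)"
      using subspace_extend_bounded_graph[OF sub le] by blast
    define H where "H = {p + q |p q. p \<in> G \<and> q \<in> span {(x, \<alpha>)}}"
    have "subspace H" unfolding H_def by (rule subspace_sums[OF sub subspace_span])
    moreover have GH: "G \<subseteq> H" 
    proof
      fix p assume "p \<in> G"
      then have "p = p + 0 \<and> p \<in> G \<and> 0 \<in> span {(x, \<alpha>)}" by (simp add: span_0)
      then show "p \<in> H" unfolding H_def by blast
    qed
    moreover have "s \<le> norm y" if "(y, s) \<in> H" for y s
      using that \<alpha> by (auto simp: H_def span_singleton)
    ultimately have "H \<in> \<A>" using G0 unfolding \<A>_def by fast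
    then have "H = G" using GH by (rule max)
    moreover have "(x, \<alpha>) \<in> H"
    proof -
      have "(x, \<alpha>) = 0 + (x, \<alpha>) \<and> 0 \<in> G \<and> (x, \<alpha>) \<in> span {(x, \<alpha>)}"
        by (simp add: subspace_0[OF sub] span_base)
      then show ?thesis unfolding H_def by blast
    qed
    ultimately show ?thesis by blast
  qed
  have uniq: "s = t" if "(x, s) \<in> G" "(x, t) \<in> G" for x s t
    using le[of 0 "s - t"] le[of 0 "t - s"] subspace_diff[OF sub that] subspace_diff[OF sub that(2,1)]
    by simp
  define \<psi> where "\<psi> x = (SOME t. (x, t) \<in> G)" for x
  have \<psi>: "(x, \<psi> x) \<in> G" for x unfolding \<psi>_def by (rule someI_ex[OF total])
  have eq: "\<psi> x = t" if "(x, t) \<in> G" for x t using uniq[OF \<psi> that] .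
  show ?thesis
  proof
    show "linear \<psi>"
    proof (rule linearI)
      show "\<psi> (x + y) = \<psi> x + \<psi> y" for x y
        using subspace_add[OF sub \<psi>[of x] \<psi>[of y]] by (intro eq) simp
      show "\<psi> (c *\<^sub>R x) = c *\<^sub>R \<psi> x" for c x
        using subspace_scale[OF sub \<psi>[of x], of c] by (intro eq) simp
    qed
    show "\<psi> k = 0" if "k \<in> S" for k
      by (rule eq) (use G0 that in \<open>force simp: G0_def\<close>)
    show "\<psi> e = 1"
      by (rule eq) (use G0 subspace_0[OF S] in \<open>force simp: G0_def\<close>)
    show "\<bar>\<psi> x\<bar> \<le> norm x" for x
      using le[OF \<psi>[of x]] le[OF subspace_neg[OF sub \<psi>[of x], simplified]] by simp
  qed
qed

section \<open>Sums of commutators\<close>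

lemma real_part_add: "real_part (x + y) = real_part x + real_part y"
  by (simp add: real_part_def star_add scaleR_add_right)

lemma real_part_scaleR: "real_part (r *\<^sub>R x) = r *\<^sub>R real_part x"
  by (simp add: real_part_def scaleR_add_right)

lemma imag_part_add: "imag_part (x + y) = imag_part x + imag_part y"
  by (simp add: imag_part_def real_part_add scaleC_add_right flip: real_part_add)

lemma imag_part_scaleR: "imag_part (r *\<^sub>R x) = r *\<^sub>R imag_part x"
  by (simp add: imag_part_def scaleC_scaleR flip: real_part_scaleR)

lemma real_part_ii: "real_part (\<i> *\<^sub>C x) = - imag_part x"
  by (simp add: imag_part_def real_part_def scaleC_scaleR flip: scaleR_minus_right)

lemma imag_part_ii: "imag_part (\<i> *\<^sub>C x) = real_part x"
  by (simp add: imag_part_def scaleC_scaleC)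

lemma norm_real_part: "norm (real_part x) \<le> norm x"
  using norm_triangle_ineq[of x "star x"] by (simp add: real_part_def)

lemma norm_imag_part: "norm (imag_part x) \<le> norm x"
  using norm_real_part[of "- \<i> *\<^sub>C x"] by (simp add: imag_part_def norm_scaleC)

lemma real_part_self_adjoint: "star x = x \<Longrightarrow> real_part x = x"
  by (simp add: real_part_def flip: scaleR_2)

lemma imag_part_self_adjoint: "star x = x \<Longrightarrow> imag_part x = 0"
  by (simp add: imag_part_def real_part_def star_scaleC)

lemma complex_decompose: "c *\<^sub>C x = Re c *\<^sub>R x + Im c *\<^sub>R (\<i> *\<^sub>C (x :: 'a::unital_cstar_algebra))"
proof -
  have "c *\<^sub>C x = (of_real (Re c) + of_real (Im c) * \<i>) *\<^sub>C x"
    by (metis complex_eq mult.commute)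
  then show ?thesis by (simp add: scaleC_add_left scaleC_of_real flip: scaleC_scaleC)
qed

text \<open>
  The complex-linear extension of \<open>\<psi>\<close> from the self-adjoint part. It is positive because \<open>\<psi>\<close> has norm one
  and attains it at \<open>1\<close>. It kills commutators because, for self-adjoint \<open>s\<close> and \<open>t\<close>, the self-commutator of
  \<open>s + \<i> t\<close> is \<open>2 \<i> [s, t]\<close>.
\<close>

lemma bounded_trace_if_functional:
  fixes \<psi> :: "'a::unital_cstar_algebra \<Rightarrow> real"
  assumes lin: "linear \<psi>" and one: "\<psi> 1 = 1" and le: "\<And>x. \<bar>\<psi> x\<bar> \<le> norm x"
    and comm: "\<And>x. \<psi> (star x * x - x * star x) = 0"
  shows "bounded_trace (\<lambda>x. Complex (\<psi> (real_part x)) (\<psi> (imag_part x)))"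
proof -
  define \<phi> where "\<phi> x = Complex (\<psi> (real_part x)) (\<psi> (imag_part x))" for x
  have add: "\<phi> (x + y) = \<phi> x + \<phi> y" for x y
    by (simp add: \<phi>_def real_part_add imag_part_add linear_add[OF lin] complex_add)
  have scaleR: "\<phi> (r *\<^sub>R x) = r *\<^sub>R \<phi> x" for r x
    by (simp add: \<phi>_def real_part_scaleR imag_part_scaleR linear_scale[OF lin] complex_eq_iff)
  have ii: "\<phi> (\<i> *\<^sub>C x) = \<i> * \<phi> x" for x
    by (simp add: \<phi>_def real_part_ii imag_part_ii linear_neg[OF lin] complex_eq_iff)
  have scale: "\<phi> (c *\<^sub>C x) = c * \<phi> x" for c x
  proof -
    have "\<phi> (c *\<^sub>C x) = (of_real (Re c) + of_real (Im c) * \<i>) * \<phi> x"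
      by (subst complex_decompose) (simp only: add scaleR ii, simp only: scaleR_conv_of_real distrib_right mult.assoc)
    also have "of_real (Re c) + of_real (Im c) * \<i> = c" by (metis complex_eq mult.commute)
    finally show ?thesis .
  qed
  have minus: "\<phi> (- x) = - \<phi> x" for x using scaleR[of "-1" x] by simp
  have diff: "\<phi> (x - y) = \<phi> x - \<phi> y" for x y using add[of x "-y"] by (simp add: minus)
  have sa: "\<phi> h = of_real (\<psi> h)" if "star h = h" for h
    using that by (simp add: \<phi>_def real_part_self_adjoint imag_part_self_adjoint linear_0[OF lin]
        complex_of_real_def)
  have sa_comm: "\<phi> (s * t) = \<phi> (t * s)" if s: "star s = s" and t: "star t = t" for s t
  proof -
    define k where "k = \<i> *\<^sub>C (s * t - t * s)"
    define x where "x = s + \<i> *\<^sub>C t"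
    have sx: "star x = s - \<i> *\<^sub>C t" by (simp add: x_def star_add star_scaleC s t)
    have "star x * x - x * star x = 2 *\<^sub>R k"
      unfolding sx unfolding x_def k_def scaleR_2
      by (simp add: distrib_left distrib_right left_diff_distrib right_diff_distrib
          mult_scaleC_left mult_scaleC_right scaleC_scaleC scaleC_add_right scaleC_diff_right)
    then have "\<psi> k = 0" using comm[of x] by (simp add: linear_scale[OF lin])
    moreover have "star k = k"
      by (simp add: k_def star_scaleC star_diff star_mult s t scaleC_diff_right)
    ultimately have "\<phi> k = 0" by (simp add: sa)
    then show ?thesis by (simp add: k_def scale diff)
  qed
  have trace: "\<phi> (x * y) = \<phi> (y * x)" for x y
  proof -
    define a b c d where "a = real_part x" and "b = imag_part x" and "c = real_part y"
      and "d = imag_part y"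
    have xy: "x = a + \<i> *\<^sub>C b" "y = c + \<i> *\<^sub>C d"
      by (simp_all add: a_def b_def c_def d_def real_imag_parts)
    have "\<phi> (a * c) = \<phi> (c * a)" "\<phi> (a * d) = \<phi> (d * a)" "\<phi> (b * c) = \<phi> (c * b)"
      "\<phi> (b * d) = \<phi> (d * b)"
      by (auto intro!: sa_comm simp: a_def b_def c_def d_def)
    then show ?thesis unfolding xy
      by (simp add: distrib_left distrib_right mult_scaleC_left mult_scaleC_right add scale)
  qed
  have nonneg: "\<psi> h \<ge> 0" if h: "pos_elem h" for h
  proof -
    obtain t where t: "t \<ge> 0" "norm (of_real t - h) \<le> t" using h by (auto simp: pos_elem_def)
    have "\<psi> (of_real t - h) = t - \<psi> h"
      by (simp add: linear_diff[OF lin] of_real_def linear_scale[OF lin] one)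
    then show ?thesis using le[of "of_real t - h"] t by simp
  qed
  have pos: "\<phi> (star x * x) \<in> \<real>\<^sub>\<ge>\<^sub>0" for x
    using nonneg[OF pos_elem_star_mult[of x]] sa[of "star x * x"]
    by (simp add: star_mult star_star)
  have "bounded_linear \<phi>"
  proof (rule bounded_linear_intro[where K = 2])
    fix x
    have "norm (\<phi> x) \<le> \<bar>\<psi> (real_part x)\<bar> + \<bar>\<psi> (imag_part x)\<bar>"
      using cmod_le[of "\<phi> x"] by (simp add: \<phi>_def)
    also have "\<dots> \<le> norm x + norm x"
      by (intro add_mono order_trans[OF le] norm_real_part norm_imag_part)
    finally show "norm (\<phi> x) \<le> norm x * 2" by simp
  qed (simp_all add: add scaleR)
  moreover have "\<phi> 1 \<noteq> 0" by (simp add: sa one)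
  ultimately have "bounded_trace \<phi>"
    unfolding bounded_trace_def using scale pos trace by blast
  then show ?thesis by (simp add: \<phi>_def[abs_def])
qed

text \<open>
  The sums of self-commutators form a real subspace: a positive scalar is absorbed by its square
  root, and exchanging \<open>x\<close> with \<open>x\<^sup>*\<close> changes the sign. If that subspace kept distance \<open>1\<close> from \<open>1\<close>,
  Hahn--Banach would produce a trace.
\<close>

lemma sum_commutators_near_one:
  assumes no_trace: "\<nexists>\<tau> :: 'a::unital_cstar_algebra \<Rightarrow> complex. bounded_trace \<tau>"
  obtains xs :: "'a::unital_cstar_algebra list" where "norm (1 - (\<Sum>x\<leftarrow>xs. star x * x - x * star x)) < 1"
proof -
  define K where "K = range (\<lambda>xs :: 'a list. \<Sum>x\<leftarrow>xs. star x * x - x * star x)"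
  have sub: "subspace K"
  proof (rule subspaceI)
    show "0 \<in> K" unfolding K_def by (rule range_eqI[of _ _ "[]"]) simp
    fix k l assume "k \<in> K" "l \<in> K"
    then obtain xs ys where "k = (\<Sum>x\<leftarrow>xs. star x * x - x * star x)"
      "l = (\<Sum>x\<leftarrow>ys. star x * x - x * star x)" by (auto simp: K_def)
    then show "k + l \<in> K" unfolding K_def by (intro range_eqI[of _ _ "xs @ ys"]) simp
  next
    fix k and c :: real assume "k \<in> K"
    then obtain xs where k: "k = (\<Sum>x\<leftarrow>xs. star x * x - x * star x)" by (auto simp: K_def)
    show "c *\<^sub>R k \<in> K"
    proof (cases "c \<ge> 0")
      case True
      have "c *\<^sub>R k = (\<Sum>x\<leftarrow>map (\<lambda>x. sqrt c *\<^sub>R x) xs. star x * x - x * star x)"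
        unfolding k using True by (induction xs) (auto simp: scaleR_add_right scaleR_diff_right)
      then show ?thesis unfolding K_def by blast
    next
      case False
      have "c *\<^sub>R k = (\<Sum>x\<leftarrow>map (\<lambda>x. sqrt (- c) *\<^sub>R star x) xs. star x * x - x * star x)"
        unfolding k using False
        by (induction xs) (auto simp: scaleR_add_right scaleR_diff_right star_star)
      then show ?thesis unfolding K_def by blast
    qed
  qed
  have "\<not> (\<forall>k\<in>K. 1 \<le> norm (1 - k))"
  proof
    assume "\<forall>k\<in>K. 1 \<le> norm (1 - k)"
    then obtain \<psi> :: "'a \<Rightarrow> real" where \<psi>: "linear \<psi>" "\<And>k. k \<in> K \<Longrightarrow> \<psi> k = 0" "\<psi> 1 = 1"
      "\<And>x. \<bar>\<psi> x\<bar> \<le> norm x"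
      using norm_one_functional_vanishing_on_subspace[OF sub, of 1] by blast
    have "star x * x - x * star x \<in> K" for x
      unfolding K_def by (rule range_eqI[of _ _ "[x]"]) simp
    then show False
      using no_trace bounded_trace_if_functional[OF \<psi>(1,3,4)] \<psi>(2) by blast
  qed
  then obtain k where "k \<in> K" "norm (1 - k) < 1" by (auto simp: not_le)
  then show ?thesis using that by (auto simp: K_def)
qed

definition conjugation_sum :: "'a::unital_cstar_algebra list \<Rightarrow> 'a \<Rightarrow> 'a::unital_cstar_algebra" where
  "conjugation_sum ys a = (\<Sum>y\<leftarrow>ys. y * a * star y)"

lemma conjugation_sum_add: "conjugation_sum ys (a + b) = conjugation_sum ys a + conjugation_sum ys b"
  unfolding conjugation_sum_def by (induction ys) (auto simp: algebra_simps)

lemma conjugation_sum_scaleC: "conjugation_sum ys (c *\<^sub>C a) = c *\<^sub>C conjugation_sum ys a"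
  unfolding conjugation_sum_def
  by (induction ys) (auto simp: scaleC_add_right mult_scaleC_left mult_scaleC_right)

lemma conjugation_sum_minus: "conjugation_sum ys (- a) = - conjugation_sum ys a"
  using conjugation_sum_scaleC[of ys "-1" a] by simp

lemma conjugation_sum_diff: "conjugation_sum ys (a - b) = conjugation_sum ys a - conjugation_sum ys b"
  using conjugation_sum_add[of ys a "-b"] by (simp add: conjugation_sum_minus)

lemma conjugation_sum_of_real: "conjugation_sum ys (of_real r) = r *\<^sub>R conjugation_sum ys 1"
  using conjugation_sum_scaleC[of ys "complex_of_real r" 1]
  by (simp only: scaleC_of_real of_real_def[where ?'a = 'a])

lemma star_conjugation_sum: "star (conjugation_sum ys a) = conjugation_sum ys (star a)"
  unfolding conjugation_sum_def
  by (induction ys) (auto simp: star_add star_mult star_star mult.assoc)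

lemma pos_elem_conjugation_sum:
  assumes "pos_elem h"
  shows "pos_elem (conjugation_sum ys h)"
proof -
  obtain s where s: "pos_elem s" "s * s = h" by (rule pos_elem_sqrt[OF assms])
  have "pos_elem (y * h * star y)" for y
    using pos_elem_star_mult[of "s * star y"] pos_elem_self_adjoint[OF s(1)]
    by (simp add: star_mult star_star mult.assoc flip: s(2))
  moreover have "pos_elem (0 :: 'a)" using pos_elem_square[of "0::'a"] by simp
  ultimately show ?thesis unfolding conjugation_sum_def
    by (induction ys) (auto intro: pos_elem_add)
qed

text \<open>
  Conjugation sums preserve positivity, so \<open>- \<parallel>a\<parallel> \<le> a \<le> \<parallel>a\<parallel>\<close> is mapped to
  \<open>- \<parallel>a\<parallel> d \<le> conjugation_sum ys a \<le> \<parallel>a\<parallel> d\<close>, where \<open>d\<close> is the image of \<open>1\<close> and \<open>d \<le> r\<close>.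
\<close>

lemma norm_conjugation_sum_le:
  assumes a: "star a = a" and r: "norm (conjugation_sum ys 1) \<le> r"
  shows "norm (conjugation_sum ys a) \<le> r * norm a"
proof -
  define d where "d = conjugation_sum ys 1"
  have "pos_elem (of_real r - d)"
    by (rule pos_elem_of_real_diff) (use r in \<open>auto simp: d_def star_conjugation_sum\<close>)
  from pos_elem_scaleR[OF this norm_ge_zero[of a]]
  have rd: "pos_elem (of_real (r * norm a) - norm a *\<^sub>R d)"
    by (simp add: scaleR_diff_right of_real_def mult.commute)
  have le: "pos_elem (of_real (r * norm a) - conjugation_sum ys b)"
    if b: "star b = b" "norm b = norm a" for b
  proof -
    have "pos_elem (conjugation_sum ys (of_real (norm a) - b))"
      using b by (intro pos_elem_conjugation_sum pos_elem_of_real_diff) auto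
    then have "pos_elem (norm a *\<^sub>R d - conjugation_sum ys b)"
      by (simp add: conjugation_sum_diff conjugation_sum_of_real d_def)
    from pos_elem_add[OF rd this] show ?thesis by simp
  qed
  show ?thesis
    using le[of a] le[of "- a"] a by (intro norm_le_if_positive) (auto simp: conjugation_sum_minus)
qed

text \<open>
  Pop's theorem. Whenever \<open>\<Sum> y\<^sup>* y = c\<close> is a scalar, the sum of the commutators \<open>[y\<^sup>*, y a]\<close> is
  \<open>c a - conjugation_sum ys a\<close>. Solving this for \<open>a\<close> is a fixed point problem, and on self-adjoint
  elements \<open>a \<mapsto> conjugation_sum ys a / c\<close> is a contraction when \<open>\<parallel>\<Sum> y y\<^sup>*\<parallel> < c\<close>.
\<close>

theorem all_sums_of_commutators:
  assumes no_trace: "\<nexists>\<tau> :: 'a::unital_cstar_algebra \<Rightarrow> complex. bounded_trace \<tau>"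
  obtains ys :: "'a::unital_cstar_algebra list" where "\<forall>x. \<exists>a. x = (\<Sum>y\<leftarrow>ys. star y * (y * a) - (y * a) * star y)"
proof -
  obtain xs :: "'a list" where near: "norm (1 - (\<Sum>x\<leftarrow>xs. star x * x - x * star x)) < 1"
    by (rule sum_commutators_near_one[OF no_trace])
  define b where "b = (\<Sum>x\<leftarrow>xs. star x * x)"
  define c where "c = max 1 (norm b)"
  have c: "c \<ge> 1" "norm b \<le> c" by (auto simp: c_def)
  have "star b = b" unfolding b_def by (induction xs) (auto simp: star_add star_mult star_star)
  from pos_elem_of_real_diff[OF this c(2)]
  have "pos_elem (of_real c - b)" .
  then obtain w where w: "pos_elem w" "w * w = of_real c - b" by (rule pos_elem_sqrt)
  have sw: "star w = w" by (rule pos_elem_self_adjoint[OF w(1)])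
  \<comment> \<open>The extra element \<open>w\<close> makes \<open>\<Sum> y\<^sup>* y\<close> scalar; being self-adjoint, it leaves the difference
    of \<open>\<Sum> y\<^sup>* y\<close> and \<open>\<Sum> y y\<^sup>*\<close> unchanged.\<close>
  define ys where "ys = w # xs"
  have sum1: "(\<Sum>y\<leftarrow>ys. star y * y) = of_real c" by (simp add: ys_def sw w b_def)
  define k where "k = (\<Sum>x\<leftarrow>xs. star x * x - x * star x)"
  have k: "k = b - (\<Sum>x\<leftarrow>xs. x * star x)" unfolding k_def b_def by (simp add: sum_list_subtractf)
  have sum2: "conjugation_sum ys 1 = of_real c - k"
    by (simp add: conjugation_sum_def ys_def sw w k)
  define r where "r = c - 1 + norm (1 - k)"
  have r: "r < c" "0 \<le> r" using near c by (auto simp: r_def k_def)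
  have "norm (of_real (c - 1) + (1 - k)) \<le> norm (of_real (c - 1) :: 'a) + norm (1 - k)"
    by (rule norm_triangle_ineq)
  also have "\<dots> = r" using c by (simp only: norm_of_real r_def)
  finally have nr: "norm (conjugation_sum ys 1) \<le> r" by (simp add: sum2)
  define L where "L a = of_real c * a - conjugation_sum ys a" for a
  have sa: "\<exists>a. L a = x" if x: "star x = x" for x
  proof -
    define f where "f a = (1 / c) *\<^sub>R (x + conjugation_sum ys a)" for a
    have "\<exists>!a. a \<in> {a. star a = a} \<and> f a = a"
    proof (rule Banach_fix[where c = "r / c"])
      show "complete {a :: 'a. star a = a}"
        unfolding complete_eq_closed
        by (intro closed_Collect_eq continuous_on_id
            linear_continuous_on bounded_linear_star)
      show "{a :: 'a. star a = a} \<noteq> {}" using star_zero by blast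
      show "0 \<le> r / c" "r / c < 1" using r c by auto
      show "f ` {a. star a = a} \<subseteq> {a. star a = a}"
        by (auto simp: f_def star_add x star_conjugation_sum)
      fix a b :: 'a assume "a \<in> {a. star a = a}" "b \<in> {a. star a = a}"
      then have "norm (conjugation_sum ys (a - b)) \<le> r * norm (a - b)"
        by (intro norm_conjugation_sum_le[OF _ nr]) (simp add: star_diff)
      moreover have "f a - f b = (1 / c) *\<^sub>R conjugation_sum ys (a - b)"
        by (simp add: f_def conjugation_sum_diff flip: scaleR_diff_right)
      ultimately show "dist (f a) (f b) \<le> r / c * dist a b"
        using c by (simp add: dist_norm divide_right_mono)
    qed
    then obtain a where "f a = a" by blast
    then have "c *\<^sub>R a = x + conjugation_sum ys a"
      using c by (metis f_def scaleR_scaleR scaleR_one nonzero_eq_divide_eq mult.commute not_one_le_zero times_divide_eq_right mult.right_neutral)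
    then show ?thesis by (intro exI[of _ a]) (simp add: L_def of_real_mult_scaleR)
  qed
  have "\<exists>a. L a = x" for x
  proof -
    obtain a1 a2 where a: "L a1 = real_part x" "L a2 = imag_part x"
      using sa[of "real_part x"] sa[of "imag_part x"] by auto
    have "L (a1 + \<i> *\<^sub>C a2) = L a1 + \<i> *\<^sub>C L a2"
      by (simp add: L_def conjugation_sum_add conjugation_sum_scaleC distrib_left
          mult_scaleC_right scaleC_diff_right)
    then show ?thesis using real_imag_parts[of x] a by metis
  qed
  moreover have "L a = (\<Sum>y\<leftarrow>ys. star y * (y * a) - (y * a) * star y)" for a
  proof -
    have "(\<Sum>y\<leftarrow>zs. star y * y) * a = (\<Sum>y\<leftarrow>zs. star y * (y * a))" for zs
      by (induction zs) (auto simp: distrib_right mult.assoc)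
    then show ?thesis
      by (simp add: L_def conjugation_sum_def sum_list_subtractf flip: sum1)
  qed
  ultimately show ?thesis using that[of ys] by metis
qed

section \<open>Maximal left ideals\<close>

definition left_ideal :: "'a::ring_1 set \<Rightarrow> bool" where
  "left_ideal M \<longleftrightarrow> 0 \<in> M \<and> (\<forall>x\<in>M. \<forall>y\<in>M. x + y \<in> M) \<and> (\<forall>a. \<forall>x\<in>M. a * x \<in> M)"

definition maximal_left_ideal :: "'a::ring_1 set \<Rightarrow> bool" where
  "maximal_left_ideal M \<longleftrightarrow>
     left_ideal M \<and> 1 \<notin> M \<and> (\<forall>N. left_ideal N \<and> M \<subseteq> N \<and> 1 \<notin> N \<longrightarrow> N = M)"

lemma left_ideal_zero: "left_ideal M \<Longrightarrow> 0 \<in> M"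
  and left_ideal_add: "left_ideal M \<Longrightarrow> x \<in> M \<Longrightarrow> y \<in> M \<Longrightarrow> x + y \<in> M"
  and left_ideal_mult: "left_ideal M \<Longrightarrow> x \<in> M \<Longrightarrow> a * x \<in> M"
  by (auto simp: left_ideal_def)

lemma left_ideal_minus: "left_ideal M \<Longrightarrow> x \<in> M \<Longrightarrow> - x \<in> M"
  using left_ideal_mult[of M x "-1"] by simp

lemma left_ideal_diff: "left_ideal M \<Longrightarrow> x \<in> M \<Longrightarrow> y \<in> M \<Longrightarrow> x - y \<in> M"
  using left_ideal_add[of M x "-y"] by (simp add: left_ideal_minus)

lemma left_ideal_sum: "left_ideal M \<Longrightarrow> (\<And>i. i \<in> I \<Longrightarrow> x i \<in> M) \<Longrightarrow> (\<Sum>i\<in>I. x i) \<in> M"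
  by (induction I rule: infinite_finite_induct) (auto simp: left_ideal_zero left_ideal_add)

lemma left_ideal_scaleC: "left_ideal M \<Longrightarrow> x \<in> M \<Longrightarrow> c *\<^sub>C (x::'a::unital_cstar_algebra) \<in> M"
  using left_ideal_mult[of M x "c *\<^sub>C 1"] by (simp add: mult_scaleC_left)

lemma left_ideal_cong: "left_ideal M \<Longrightarrow> x - y \<in> M \<Longrightarrow> x \<in> M \<longleftrightarrow> y \<in> M"
  using left_ideal_add[of M "x - y" y] left_ideal_diff[of M x "x - y"] by auto

lemma maximal_left_idealD:
  assumes "maximal_left_ideal M"
  shows "left_ideal M" "1 \<notin> M" "\<And>N. left_ideal N \<Longrightarrow> M \<subseteq> N \<Longrightarrow> 1 \<notin> N \<Longrightarrow> N = M"
  using assms by (auto simp: maximal_left_ideal_def)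

lemma exists_maximal_left_ideal:
  assumes I: "left_ideal I" "1 \<notin> I"
  obtains M where "maximal_left_ideal M" "I \<subseteq> M"
proof -
  define \<A> where "\<A> = {N. left_ideal N \<and> I \<subseteq> N \<and> 1 \<notin> N}"
  have "I \<in> \<A>" using I by (simp add: \<A>_def)
  moreover have "\<Union>\<C> \<in> \<A>" if ne: "\<C> \<noteq> {}" and ch: "subset.chain \<A> \<C>" for \<C>
  proof -
    have mem: "\<And>N. N \<in> \<C> \<Longrightarrow> left_ideal N \<and> I \<subseteq> N \<and> 1 \<notin> N"
      using ch by (auto simp: subset.chain_def \<A>_def)
    have "x + y \<in> \<Union>\<C>" if xy: "x \<in> \<Union>\<C>" "y \<in> \<Union>\<C>" for x y
    proof -
      obtain N N' where "N \<in> \<C>" "N' \<in> \<C>" "x \<in> N" "y \<in> N'" using xy by blast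
      moreover from this have "N \<subseteq> N' \<or> N' \<subseteq> N" using ch by (auto simp: subset.chain_def)
      ultimately show ?thesis using mem left_ideal_add by blast
    qed
    moreover have "0 \<in> \<Union>\<C>" using ne mem left_ideal_zero by blast
    moreover have "a * x \<in> \<Union>\<C>" if "x \<in> \<Union>\<C>" for a x using that mem left_ideal_mult by blast
    ultimately have "left_ideal (\<Union>\<C>)" by (simp add: left_ideal_def)
    then show ?thesis using mem ne by (auto simp: \<A>_def)
  qed
  ultimately obtain M where "M \<in> \<A>" "\<forall>N\<in>\<A>. M \<subseteq> N \<longrightarrow> N = M"
    using subset_Zorn_nonempty[of \<A>] by blast
  then show ?thesis using that[of M] by (auto simp: \<A>_def maximal_left_ideal_def)
qed

lemma inverse_modulo_maximal_left_ideal: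
  assumes M: "maximal_left_ideal M" and v: "v \<notin> M"
  obtains a where "a * v - 1 \<in> M"
proof -
  note li = maximal_left_idealD(1)[OF M]
  define N where "N = {m + a * v |m a. m \<in> M}"
  have mem: "m + a * v \<in> N" if "m \<in> M" for m a using that by (auto simp: N_def)
  have "left_ideal N" unfolding left_ideal_def
  proof (intro conjI ballI allI)
    show "0 \<in> N" using mem[of 0 0] left_ideal_zero[OF li] by simp
    fix x assume "x \<in> N"
    then obtain m a where x: "x = m + a * v" "m \<in> M" by (auto simp: N_def)
    show "b * x \<in> N" for b
      using mem[OF left_ideal_mult[OF li x(2)], of b "b * a"] by (simp add: x distrib_left mult.assoc)
    fix y assume "y \<in> N"
    then obtain k b where y: "y = k + b * v" "k \<in> M" by (auto simp: N_def)
    show "x + y \<in> N"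
      using mem[OF left_ideal_add[OF li x(2) y(2)], of "a + b"] by (simp add: x y algebra_simps)
  qed
  moreover have "M \<subseteq> N" using mem[of _ 0] by auto
  moreover have "v \<in> N" using mem[of 0 1] left_ideal_zero[OF li] by simp
  ultimately have "1 \<in> N" using maximal_left_idealD(3)[OF M, of N] v by blast
  then obtain m a where "1 = m + a * v" "m \<in> M" by (auto simp: N_def)
  then have "a * v - 1 = - m" by (simp add: algebra_simps)
  then show ?thesis using that left_ideal_minus[OF li \<open>m \<in> M\<close>] by metis
qed

lemma geometric_series:
  fixes z :: "'a::{real_normed_algebra_1,banach}"
  assumes "norm z < 1"
  shows "summable (\<lambda>n. z ^ n)" "suminf (\<lambda>n. z ^ n) * (1 - z) = 1"
    "norm (suminf (\<lambda>n. z ^ n)) \<le> 1 / (1 - norm z)"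
proof -
  have g: "summable (\<lambda>n. norm z ^ n)" using assms by (simp add: summable_geometric)
  have sn: "summable (\<lambda>n. norm (z ^ n))"
    by (rule summable_comparison_test'[OF g, of 0]) (simp add: norm_power_ineq)
  then show s: "summable (\<lambda>n. z ^ n)" by (rule summable_norm_cancel)
  have "suminf (\<lambda>n. z ^ n) = 1 + suminf (\<lambda>n. z ^ n * z)"
    using suminf_split_head[OF s] by (simp add: power_Suc2 del: power_Suc)
  also have "suminf (\<lambda>n. z ^ n * z) = suminf (\<lambda>n. z ^ n) * z"
    using suminf_mult2[OF s] by simp
  finally show "suminf (\<lambda>n. z ^ n) * (1 - z) = 1" by (simp add: algebra_simps)
  have "norm (suminf (\<lambda>n. z ^ n)) \<le> suminf (\<lambda>n. norm (z ^ n))" by (rule summable_norm[OF sn])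
  also have "\<dots> \<le> suminf (\<lambda>n. norm z ^ n)" by (rule suminf_le[OF _ sn g]) (rule norm_power_ineq)
  also have "\<dots> = 1 / (1 - norm z)" using assms by (simp add: suminf_geometric)
  finally show "norm (suminf (\<lambda>n. z ^ n)) \<le> 1 / (1 - norm z)" .
qed

text \<open>
  An element at distance less than \<open>1\<close> from \<open>1\<close> has a left inverse, given by the geometric series.
\<close>

lemma proper_left_ideal_distance:
  fixes M :: "'a::{real_normed_algebra_1,banach} set"
  assumes "left_ideal M" "1 \<notin> M" "x \<in> M"
  shows "1 \<le> norm (1 - x)"
proof (rule ccontr)
  assume "\<not> 1 \<le> norm (1 - x)"
  then have "suminf (\<lambda>n. (1 - x) ^ n) * x = 1" using geometric_series(2)[of "1 - x"] by simp
  then show False using assms left_ideal_mult by metis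
qed

lemma scaleC_power: "(c *\<^sub>C x) ^ n = c ^ n *\<^sub>C (x ^ n :: 'a::unital_cstar_algebra)"
  by (induction n) (auto simp: mult_scaleC_left mult_scaleC_right scaleC_scaleC mult.commute)

lemma complex_functional_of_real:
  fixes \<psi> :: "'a::unital_cstar_algebra \<Rightarrow> real"
  assumes lin: "linear \<psi>" and le: "\<And>x. \<bar>\<psi> x\<bar> \<le> norm x"
  obtains \<phi> :: "'a \<Rightarrow> complex" where "bounded_linear \<phi>" "\<And>c x. \<phi> (c *\<^sub>C x) = c * \<phi> x"
    "\<And>x. Re (\<phi> x) = \<psi> x" "\<And>x. \<phi> x = Complex (\<psi> x) (- \<psi> (\<i> *\<^sub>C x))"
proof -
  define \<phi> where "\<phi> x = Complex (\<psi> x) (- \<psi> (\<i> *\<^sub>C x))" for x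
  have add: "\<phi> (x + y) = \<phi> x + \<phi> y" for x y
    by (simp add: \<phi>_def scaleC_add_right linear_add[OF lin] complex_eq_iff)
  have scaleR: "\<phi> (r *\<^sub>R x) = r *\<^sub>R \<phi> x" for r x
    by (simp add: \<phi>_def scaleC_scaleR linear_scale[OF lin] complex_eq_iff)
  have ii: "\<phi> (\<i> *\<^sub>C x) = \<i> * \<phi> x" for x
    by (simp add: \<phi>_def scaleC_scaleC linear_neg[OF lin] complex_eq_iff)
  show ?thesis
  proof
    show "bounded_linear \<phi>"
    proof (rule bounded_linear_intro[where K = 2])
      fix x
      have "norm (\<phi> x) \<le> \<bar>\<psi> x\<bar> + \<bar>\<psi> (\<i> *\<^sub>C x)\<bar>" using cmod_le[of "\<phi> x"] by (simp add: \<phi>_def)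
      then show "norm (\<phi> x) \<le> norm x * 2"
        using le[of x] le[of "\<i> *\<^sub>C x"] by (simp add: norm_scaleC)
    qed (simp_all add: add scaleR)
    show "\<phi> (c *\<^sub>C x) = c * \<phi> x" for c x
    proof -
      have "\<phi> (c *\<^sub>C x) = (of_real (Re c) + of_real (Im c) * \<i>) * \<phi> x"
        by (subst complex_decompose)
          (simp only: add scaleR ii, simp only: scaleR_conv_of_real distrib_right mult.assoc)
      also have "of_real (Re c) + of_real (Im c) * \<i> = c" by (metis complex_eq mult.commute)
      finally show ?thesis .
    qed
  qed (simp_all add: \<phi>_def)
qed

text \<open>
  Right multiplication by \<open>b\<close> induces an endomorphism of the simple module \<open>A/M\<close>, and the claim is that
  this endomorphism is a scalar; working modulo \<open>M\<close> stands in for the quotient. If \<open>b - c\<close> never lies in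
  \<open>M\<close>, it has an inverse \<open>R c\<close> modulo \<open>M\<close>. A bounded functional that vanishes on \<open>M\<close> turns the resolvent
  \<open>R\<close> into an entire function that tends to \<open>0\<close> at infinity, hence into \<open>0\<close> by Liouville's theorem.
\<close>

theorem gelfand_mazur_modulo_maximal_left_ideal:
  fixes M :: "'a::unital_cstar_algebra set"
  assumes M: "maximal_left_ideal M" and b: "\<And>m. m \<in> M \<Longrightarrow> m * b \<in> M"
  obtains c where "b - c *\<^sub>C 1 \<in> M"
proof (rule ccontr)
  assume "\<not> thesis"
  then have notin: "b - c *\<^sub>C 1 \<notin> M" for c using that by blast
  note li = maximal_left_idealD(1)[OF M] and one = maximal_left_idealD(2)[OF M]
  define R where "R c = (SOME a. a * (b - c *\<^sub>C 1) - 1 \<in> M)" for c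
  have R: "R c * (b - c *\<^sub>C 1) - 1 \<in> M" for c
    unfolding R_def by (rule inverse_modulo_maximal_left_ideal[OF M notin]) (rule someI)
  \<comment> \<open>Schur's lemma: the nonzero endomorphism induced by \<open>b - c\<close> is injective.\<close>
  have cancel: "a \<in> M" if "a * (b - c *\<^sub>C 1) \<in> M" for a c
  proof -
    define N where "N = {a. a * (b - c *\<^sub>C 1) \<in> M}"
    have "left_ideal N"
      unfolding left_ideal_def N_def
      by (auto simp: left_ideal_zero[OF li] left_ideal_add[OF li] left_ideal_mult[OF li]
          distrib_right mult.assoc)
    moreover have "M \<subseteq> N"
      using b by (auto simp: N_def right_diff_distrib mult_scaleC_right
          intro!: left_ideal_diff[OF li] left_ideal_scaleC[OF li])
    moreover have "1 \<notin> N" using notin by (simp add: N_def)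
    ultimately have "N = M" by (rule maximal_left_idealD(3)[OF M])
    then show ?thesis using that by (auto simp: N_def)
  qed
  obtain \<psi> :: "'a \<Rightarrow> real" where \<psi>: "linear \<psi>" "\<And>k. k \<in> M \<Longrightarrow> \<psi> k = 0" "\<psi> 1 = 1"
    "\<And>x. \<bar>\<psi> x\<bar> \<le> norm x"
  proof -
    have "subspace M"
      by (rule subspaceI) (auto simp: left_ideal_zero[OF li] left_ideal_add[OF li]
          left_ideal_scaleC[OF li] simp flip: scaleC_of_real)
    then show ?thesis
      using norm_one_functional_vanishing_on_subspace[OF _ proper_left_ideal_distance[OF li one]] that
      by metis
  qed
  obtain \<theta> :: "'a \<Rightarrow> complex" where \<theta>: "bounded_linear \<theta>" "\<And>c x. \<theta> (c *\<^sub>C x) = c * \<theta> x"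
    "\<And>x. Re (\<theta> x) = \<psi> x" "\<And>x. \<theta> x = Complex (\<psi> x) (- \<psi> (\<i> *\<^sub>C x))"
    using complex_functional_of_real[OF \<psi>(1,4)] by metis
  \<comment> \<open>With the factor \<open>b\<close>, the value at \<open>R 0\<close> is that of \<open>\<theta>\<close> at \<open>R 0 * b\<close>, which equals \<open>1\<close>
    modulo \<open>M\<close>; so the entire function \<open>F\<close> below does not vanish at \<open>0\<close>.\<close>
  define \<phi> where "\<phi> x = \<theta> (x * b)" for x
  have \<phi>: "bounded_linear \<phi>" unfolding \<phi>_def
    by (rule bounded_linear_compose[OF \<theta>(1) bounded_linear_mult_left])
  have \<phi>_scale: "\<phi> (c *\<^sub>C x) = c * \<phi> x" for c x by (simp add: \<phi>_def mult_scaleC_left \<theta>(2))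
  have \<phi>_M: "\<phi> m = 0" if "m \<in> M" for m
    using b[OF that] left_ideal_scaleC[OF li b[OF that], of \<i>]
    by (simp add: \<phi>_def \<theta>(4) \<psi>(2) zero_complex.code)
  define F where "F c = \<phi> (R c)" for c
  \<comment> \<open>The inverse modulo \<open>M\<close> is unique modulo \<open>M\<close>, so \<open>F\<close> may be computed with any inverse: with a
    power series around \<open>\<mu>\<close>, and with the Neumann series near infinity.\<close>
  have F: "\<phi> a = F c" if "a * (b - c *\<^sub>C 1) - 1 \<in> M" for a c
  proof -
    have "(a - R c) * (b - c *\<^sub>C 1) \<in> M"
      using left_ideal_diff[OF li that R[of c]] by (simp add: left_diff_distrib)
    from \<phi>_M[OF cancel[OF this]] show ?thesis
      by (simp add: F_def linear_diff[OF bounded_linear.linear[OF \<phi>]])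
  qed
  have holo: "F holomorphic_on UNIV"
  proof -
    have "F field_differentiable at \<mu>" for \<mu>
    proof -
      define K where "K = R \<mu>"
      define r where "r = 1 / (norm K + 1)"
      have r: "r > 0" by (simp add: r_def add_nonneg_pos)
      have "(\<lambda>n. \<phi> (K ^ n * K) * (w - \<mu>) ^ n) sums F w" if w: "w \<in> ball \<mu> r" for w
      proof -
        define z where "z = (w - \<mu>) *\<^sub>C K"
        have "norm K + 1 > 0" by (simp add: add_nonneg_pos)
        moreover have "norm (w - \<mu>) < 1 / (norm K + 1)"
          using w by (simp add: r_def dist_norm norm_minus_commute)
        ultimately have "norm (w - \<mu>) * (norm K + 1) < 1" by (simp only: pos_less_divide_eq)
        then have z: "norm z < 1"
          using norm_ge_zero[of "w - \<mu>"] unfolding z_def norm_scaleC by (simp only: distrib_left)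
        define s where "s = suminf (\<lambda>n. z ^ n)"
        have s: "s * (1 - z) = 1" unfolding s_def by (rule geometric_series(2)[OF z])
        have "s * K * (b - w *\<^sub>C 1) - 1 = s * (K * (b - \<mu> *\<^sub>C 1) - 1) + (s * (1 - z) - 1)"
          by (simp add: z_def algebra_simps mult_scaleC_left mult_scaleC_right scaleC_diff_left)
        also have "\<dots> \<in> M" using left_ideal_mult[OF li R[of \<mu>], of s] by (simp add: s K_def)
        finally have Fw: "\<phi> (s * K) = F w" by (rule F)
        have "(\<lambda>n. z ^ n * K) sums (s * K)"
          unfolding s_def by (rule sums_mult2[OF summable_sums[OF geometric_series(1)[OF z]]])
        from bounded_linear.sums[OF \<phi> this]
        show ?thesis
          by (simp add: Fw z_def scaleC_power mult_scaleC_left \<phi>_scale mult.commute)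
      qed
      then have "F holomorphic_on ball \<mu> r" by (rule power_series_holomorphic)
      then show ?thesis using r by (simp add: holomorphic_on_imp_differentiable_at)
    qed
    then show ?thesis by (simp add: holomorphic_on_def)
  qed
  have lim: "(F \<longlongrightarrow> 0) at_infinity"
  proof -
    obtain C where C: "\<And>x. norm (\<phi> x) \<le> norm x * C" "C > 0"
      using bounded_linear.pos_bounded[OF \<phi>] by blast
    have bd: "norm (F c) \<le> 2 * C / norm c" if c: "norm c \<ge> 2 * norm b + 1" for c
    proof -
      have c0: "c \<noteq> 0" 
      proof
        assume "c = 0"
        then have "2 * norm b + 1 \<le> 0" using c by simp
        then show False using norm_ge_zero[of b] by linarith
      qed
      define z where "z = (1 / c) *\<^sub>C b"
      have z: "norm z \<le> 1/2" using c c0 by (simp add: z_def norm_scaleC norm_divide field_simps)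
      then have z1: "norm z < 1" by simp
      define s where "s = suminf (\<lambda>n. z ^ n)"
      have s: "s * (1 - z) = 1" unfolding s_def by (rule geometric_series(2)[OF z1])
      have "norm s \<le> 1 / (1 - norm z)" unfolding s_def by (rule geometric_series(3)[OF z1])
      also have "\<dots> \<le> 2" using z by (simp add: field_simps)
      finally have ns: "norm s \<le> 2" .
      have "((- 1 / c) *\<^sub>C s) * (b - c *\<^sub>C 1) = s * (1 - z)"
        using c0 by (simp add: z_def algebra_simps mult_scaleC_left mult_scaleC_right scaleC_scaleC
            scaleC_diff_right)
      then have "((- 1 / c) *\<^sub>C s) * (b - c *\<^sub>C 1) - 1 \<in> M"
        using s left_ideal_zero[OF li] by simp
      then have "F c = (- 1 / c) * \<phi> s" using F \<phi>_scale by metis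
      then have "norm (F c) = norm (\<phi> s) / norm c" by (simp add: norm_mult norm_divide)
      also have "norm (\<phi> s) \<le> 2 * C" 
        by (rule order_trans[OF C(1) mult_right_mono[OF ns less_imp_le[OF C(2)]]])
      finally show ?thesis by (simp add: divide_right_mono)
    qed
    show ?thesis
    proof (rule Lim_null_comparison)
      show "\<forall>\<^sub>F c in at_infinity. norm (F c) \<le> 2 * C / norm c"
        unfolding eventually_at_infinity using bd by blast
      show "((\<lambda>c. 2 * C / norm c) \<longlongrightarrow> 0) at_infinity"
        by (rule tendsto_divide_0[OF tendsto_const
              filterlim_at_top_imp_at_infinity[OF filterlim_norm_at_top]])
    qed
  qed
  have "F 0 = 0" by (rule Liouville_weak[OF holo lim])
  then have "\<psi> (R 0 * b) = 0" using \<theta>(3)[of "R 0 * b"] by (simp add: F_def \<phi>_def)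
  moreover have "\<psi> (R 0 * b - 1) = 0" using R[of 0] by (intro \<psi>(2)) simp
  ultimately show False by (simp add: linear_diff[OF \<psi>(1)] \<psi>(3))
qed

section \<open>Density\<close>

text \<open>
  The elements whose class in \<open>A/M\<close> lies in the complex linear span of the classes of a list.
\<close>

fun modulo_span :: "'a::unital_cstar_algebra set \<Rightarrow> 'a list \<Rightarrow> 'a set" where
  "modulo_span M [] = M"
| "modulo_span M (u # us) = {w. \<exists>c. w - c *\<^sub>C u \<in> modulo_span M us}"

fun independent_modulo :: "'a::unital_cstar_algebra set \<Rightarrow> 'a list \<Rightarrow> bool" where
  "independent_modulo M [] \<longleftrightarrow> True"
| "independent_modulo M (u # us) \<longleftrightarrow> u \<notin> modulo_span M us \<and> independent_modulo M us"

lemma modulo_span_superset: "x \<in> M \<Longrightarrow> x \<in> modulo_span M us"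
  by (induction us) (auto intro: exI[of _ 0])

text \<open>
  Jacobson density for the simple module \<open>A/M\<close>: a vector outside the span of \<open>us\<close> can be separated from
  \<open>us\<close> by the action of one element. Let \<open>J\<close> be the annihilator of \<open>us\<close>, and let \<open>u\<close> be one vector
  more. If \<open>a u = 0\<close> forces \<open>a w = 0\<close> for all \<open>a\<close> in \<open>J\<close>, then \<open>a u \<mapsto> a w\<close> is a well-defined
  endomorphism, hence a scalar \<open>c\<close>, and \<open>J\<close> annihilates \<open>w - c u\<close>, against the induction hypothesis.
\<close>

theorem density:
  fixes M :: "'a::unital_cstar_algebra set"
  assumes M: "maximal_left_ideal M" and w: "w \<notin> modulo_span M us"
  shows "\<exists>a. (\<forall>u\<in>set us. a * u \<in> M) \<and> a * w \<notin> M"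
  using w
proof (induction us arbitrary: w)
  case Nil
  then show ?case by (intro exI[of _ 1]) auto
next
  case (Cons u us)
  note li = maximal_left_idealD(1)[OF M]
  have w: "w - c *\<^sub>C u \<notin> modulo_span M us" for c using Cons.prems by auto
  define J where "J = {a. \<forall>v\<in>set us. a * v \<in> M}"
  have J_mult: "x * a \<in> J" if "a \<in> J" for x a
    using that by (auto simp: J_def mult.assoc left_ideal_mult[OF li])
  have J_diff: "a - b \<in> J" if "a \<in> J" "b \<in> J" for a b
    using that by (auto simp: J_def left_diff_distrib left_ideal_diff[OF li])
  show ?case
  proof (rule ccontr)
    assume neg: "\<nexists>a. (\<forall>v\<in>set (u # us). a * v \<in> M) \<and> a * w \<notin> M"
    then have kill: "a * w \<in> M" if "a \<in> J" "a * u \<in> M" for a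
      using that by (auto simp: J_def)
    obtain a where "a \<in> J" "a * w \<notin> M"
      using Cons.IH[OF w[of 0]] by (auto simp: J_def)
    with kill have "a * u \<notin> M" by blast
    then obtain x where "x * (a * u) - 1 \<in> M" by (rule inverse_modulo_maximal_left_ideal[OF M])
    define e where "e = x * a"
    have eJ: "e \<in> J" using \<open>a \<in> J\<close> by (simp add: e_def J_mult)
    have eu: "e * u - 1 \<in> M" using \<open>x * (a * u) - 1 \<in> M\<close> by (simp add: e_def mult.assoc)
    \<comment> \<open>Modulo \<open>M\<close>, the element \<open>e\<close> sends \<open>u\<close> to \<open>1\<close>, so \<open>b\<close> represents the image of \<open>1\<close> under the
      endomorphism \<open>a u \<mapsto> a w\<close>, and that endomorphism is right multiplication by \<open>b\<close>.\<close>
    define b where "b = e * w"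
    have "m * b \<in> M" if "m \<in> M" for m
    proof -
      have "m * e * u - m \<in> M"
        using left_ideal_mult[OF li eu, of m] by (simp add: right_diff_distrib mult.assoc)
      then have "m * e * u \<in> M" using that left_ideal_cong[OF li] by blast
      from kill[OF J_mult[OF eJ] this] show ?thesis by (simp add: b_def mult.assoc)
    qed
    then obtain c where c: "b - c *\<^sub>C 1 \<in> M"
      using gelfand_mazur_modulo_maximal_left_ideal[OF M] by metis
    have "a * (w - c *\<^sub>C u) \<in> M" if "a \<in> J" for a
    proof -
      have "(a - a * u * e) * u \<in> M"
        using left_ideal_minus[OF li left_ideal_mult[OF li eu, of "a * u"]]
        by (simp add: algebra_simps)
      then have "(a - a * u * e) * w \<in> M" using kill J_diff J_mult eJ that by blast
      moreover have "a * u * (b - c *\<^sub>C 1) \<in> M" by (rule left_ideal_mult[OF li c])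
      ultimately have "(a - a * u * e) * w + a * u * (b - c *\<^sub>C 1) \<in> M"
        by (rule left_ideal_add[OF li])
      then show ?thesis
        by (simp add: b_def algebra_simps mult_scaleC_right)
    qed
    then show False using Cons.IH[OF w[of c]] by (auto simp: J_def)
  qed
qed

section \<open>Finite-dimensional quotients\<close>

lemma modulo_span_sum:
  fixes M :: "'a::unital_cstar_algebra set"
  assumes li: "left_ideal M"
  shows "w \<in> modulo_span M us \<longleftrightarrow> (\<exists>c. w - (\<Sum>i<length us. c i *\<^sub>C (us ! i)) \<in> M)"
proof (induction us arbitrary: w)
  case (Cons u us)
  show ?case
  proof
    assume "w \<in> modulo_span M (u # us)"
    then obtain c0 c where "w - c0 *\<^sub>C u - (\<Sum>i<length us. c i *\<^sub>C (us ! i)) \<in> M"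
      using Cons.IH by auto
    then show "\<exists>c. w - (\<Sum>i<length (u # us). c i *\<^sub>C ((u # us) ! i)) \<in> M"
      by (intro exI[of _ "case_nat c0 c"])
        (simp add: sum.lessThan_Suc_shift diff_diff_eq del: sum.lessThan_Suc)
  next
    assume "\<exists>c. w - (\<Sum>i<length (u # us). c i *\<^sub>C ((u # us) ! i)) \<in> M"
    then obtain c where "w - (\<Sum>i<length (u # us). c i *\<^sub>C ((u # us) ! i)) \<in> M" by blast
    then have "(w - c 0 *\<^sub>C u) - (\<Sum>i<length us. c (Suc i) *\<^sub>C (us ! i)) \<in> M"
      by (simp add: sum.lessThan_Suc_shift diff_diff_eq del: sum.lessThan_Suc)
    then show "w \<in> modulo_span M (u # us)" using Cons.IH[of "w - c 0 *\<^sub>C u"]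
      by (auto intro!: exI[of _ "c 0"] exI[of _ "\<lambda>i. c (Suc i)"])
  qed
qed auto

lemma independent_modulo_coeffs_zero:
  fixes M :: "'a::unital_cstar_algebra set"
  assumes li: "left_ideal M"
  shows "independent_modulo M us \<Longrightarrow> (\<Sum>i<length us. c i *\<^sub>C (us ! i)) \<in> M \<Longrightarrow>
    i < length us \<Longrightarrow> c i = 0"
proof (induction us arbitrary: c i)
  case (Cons u us)
  have sum: "c 0 *\<^sub>C u + (\<Sum>i<length us. c (Suc i) *\<^sub>C (us ! i)) \<in> M"
    using Cons.prems(2) by (simp add: sum.lessThan_Suc_shift del: sum.lessThan_Suc)
  have c0: "c 0 = 0"
  proof (rule ccontr)
    assume c0: "c 0 \<noteq> 0"
    have "(1 / c 0) *\<^sub>C (c 0 *\<^sub>C u + (\<Sum>i<length us. c (Suc i) *\<^sub>C (us ! i)))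
        = u - (\<Sum>i<length us. (- c (Suc i) / c 0) *\<^sub>C (us ! i))"
      using c0 by (simp add: scaleC_add_right scaleC_scaleC scaleC_sum_right sum_negf)
    then have "u - (\<Sum>i<length us. (- c (Suc i) / c 0) *\<^sub>C (us ! i)) \<in> M"
      using left_ideal_scaleC[OF li sum, of "1 / c 0"] by simp
    then have "u \<in> modulo_span M us" unfolding modulo_span_sum[OF li]
      by (rule exI[of _ "\<lambda>i. - c (Suc i) / c 0"])
    then show False using Cons.prems(1) by simp
  qed
  show ?case
  proof (cases i)
    case 0
    then show ?thesis using c0 by simp
  next
    case (Suc j)
    then show ?thesis using Cons.IH[of "\<lambda>i. c (Suc i)" j] Cons.prems sum c0 by simp
  qed
qed simp

text \<open>
  The trace of the matrix by which an element acts on \<open>A/M\<close> with basis \<open>us\<close>; its value at \<open>1\<close> is the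
  dimension, which is positive as \<open>1 \<notin> M\<close>.
\<close>

lemma trace_if_finite_dimensional:
  fixes M :: "'a::unital_cstar_algebra set"
  assumes li: "left_ideal M" and one: "1 \<notin> M"
    and ind: "independent_modulo M us" and span: "\<And>w. w \<in> modulo_span M us"
  obtains \<tau> :: "'a \<Rightarrow> complex"
    where "\<And>x y. \<tau> (x + y) = \<tau> x + \<tau> y" "\<And>x y. \<tau> (x * y) = \<tau> (y * x)" "\<tau> 1 \<noteq> 0"
proof -
  define n where "n = length us"
  define u where "u i = us ! i" for i
  define L where "L w = (SOME c. w - (\<Sum>i<n. c i *\<^sub>C u i) \<in> M)" for w
  have L: "w - (\<Sum>i<n. L w i *\<^sub>C u i) \<in> M" for w
    unfolding L_def using span[of w] unfolding modulo_span_sum[OF li] n_def u_def by (rule someI_ex)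
  have L_eq: "L w i = c i" if "w - (\<Sum>i<n. c i *\<^sub>C u i) \<in> M" "i < n" for w c i
  proof -
    have "(\<Sum>i<n. (L w i - c i) *\<^sub>C u i) \<in> M"
      using left_ideal_diff[OF li that(1) L[of w]] by (simp add: scaleC_diff_left sum_subtractf)
    then have "L w i - c i = 0"
      using independent_modulo_coeffs_zero[OF li ind, of "\<lambda>i. L w i - c i" i] that(2)
      by (simp add: n_def u_def)
    then show ?thesis by simp
  qed
  have L_add: "L (x + y) i = L x i + L y i" if "i < n" for x y i
    using left_ideal_add[OF li L[of x] L[of y]] that
    by (intro L_eq) (simp_all add: scaleC_add_left sum.distrib algebra_simps)
  have n: "n > 0"
  proof (rule ccontr)
    assume "\<not> n > 0"
    then show False using span[of 1] one by (simp add: n_def)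
  qed
  define \<tau> where "\<tau> a = (\<Sum>i<n. L (a * u i) i)" for a
  have prod: "\<tau> (a * b) = (\<Sum>i<n. \<Sum>j<n. L (b * u i) j * L (a * u j) i)" for a b
  proof -
    have "L (a * b * u i) i = (\<Sum>j<n. L (b * u i) j * L (a * u j) i)" if i: "i < n" for i
    proof -
      define c where "c k = (\<Sum>j<n. L (b * u i) j * L (a * u j) k)" for k
      have "a * b * u i - (\<Sum>k<n. c k *\<^sub>C u k) =
          a * (b * u i - (\<Sum>j<n. L (b * u i) j *\<^sub>C u j)) +
          (\<Sum>j<n. L (b * u i) j *\<^sub>C (a * u j - (\<Sum>k<n. L (a * u j) k *\<^sub>C u k)))"
      proof -
        have "(\<Sum>k<n. c k *\<^sub>C u k) = (\<Sum>j<n. L (b * u i) j *\<^sub>C (\<Sum>k<n. L (a * u j) k *\<^sub>C u k))"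
          unfolding c_def scaleC_sum_left scaleC_sum_right scaleC_scaleC by (rule sum.swap)
        then show ?thesis
          by (simp add: right_diff_distrib sum_distrib_left mult_scaleC_right scaleC_diff_right
              sum_subtractf mult.assoc)
      qed
      also have "\<dots> \<in> M"
        by (intro left_ideal_add[OF li] left_ideal_mult[OF li] left_ideal_sum[OF li]
            left_ideal_scaleC[OF li] L)
      finally show ?thesis using L_eq[of _ c, OF _ i] by (simp add: c_def)
    qed
    then show ?thesis unfolding \<tau>_def by simp
  qed
  show ?thesis
  proof
    show "\<tau> (x + y) = \<tau> x + \<tau> y" for x y
      unfolding \<tau>_def by (simp add: distrib_right L_add sum.distrib)
    show "\<tau> (x * y) = \<tau> (y * x)" for x y
      unfolding prod by (subst sum.swap) (simp add: mult.commute)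
    have "L (1 * u i) i = 1" if "i < n" for i
    proof -
      have "(\<Sum>k<n. (if k = i then 1 else 0) *\<^sub>C u k) = u i"
        using that by (simp add: if_distrib[of "\<lambda>c. c *\<^sub>C _"] sum.delta cong: if_cong)
      then show ?thesis using L_eq[of "u i" "\<lambda>k. if k = i then 1 else 0" i] that
        by (simp add: left_ideal_zero[OF li])
    qed
    then have "\<tau> 1 = of_nat n" unfolding \<tau>_def by simp
    then show "\<tau> 1 \<noteq> 0" using n by simp
  qed
qed

lemma long_independent_modulo:
  fixes M :: "'a::unital_cstar_algebra set"
  assumes M: "maximal_left_ideal M"
    and no_trace: "\<nexists>\<tau> :: 'a \<Rightarrow> complex. (\<forall>x y. \<tau> (x + y) = \<tau> x + \<tau> y) \<and>
      (\<forall>x y. \<tau> (x * y) = \<tau> (y * x)) \<and> \<tau> 1 \<noteq> 0"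
  shows "\<exists>us. length us = n \<and> independent_modulo M us"
proof (induction n)
  case (Suc n)
  then obtain us where us: "length us = n" "independent_modulo M us" by blast
  have "\<exists>w. w \<notin> modulo_span M us"
  proof (rule ccontr)
    assume "\<nexists>w. w \<notin> modulo_span M us"
    then obtain \<tau> :: "'a \<Rightarrow> complex"
      where "\<And>x y. \<tau> (x + y) = \<tau> x + \<tau> y" "\<And>x y. \<tau> (x * y) = \<tau> (y * x)" "\<tau> 1 \<noteq> 0"
      using trace_if_finite_dimensional[OF maximal_left_idealD(1,2)[OF M] us(2)] by blast
    then show False using no_trace by blast
  qed
  then obtain w where "w \<notin> modulo_span M us" by blast
  then show ?case using us by (intro exI[of _ "w # us"]) simp
qed simp

lemma independent_modulo_nth:
  "independent_modulo M us \<Longrightarrow> i < length us \<Longrightarrow> us ! i \<notin> modulo_span M (drop (Suc i) us)"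
proof (induction us arbitrary: i)
  case (Cons u us)
  then show ?case by (cases i) auto
qed simp

text \<open>
  The order of the list matters: \<open>us ! Suc k\<close> is independent of the later vectors, and density is
  applied against those.
\<close>

lemma shift_elements:
  fixes M :: "'a::unital_cstar_algebra set"
  assumes M: "maximal_left_ideal M" and ind: "independent_modulo M us"
    and k: "Suc k < length us"
  obtains z where "z * us ! Suc k - us ! k \<in> M"
    "\<And>j. Suc k < j \<Longrightarrow> j < length us \<Longrightarrow> z * us ! j \<in> M"
proof -
  note li = maximal_left_idealD(1)[OF M]
  obtain a where a: "\<forall>u\<in>set (drop (Suc (Suc k)) us). a * u \<in> M" "a * us ! Suc k \<notin> M"
    using density[OF M independent_modulo_nth[OF ind k]] by blast
  obtain x where x: "x * (a * us ! Suc k) - 1 \<in> M"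
    by (rule inverse_modulo_maximal_left_ideal[OF M a(2)])
  show ?thesis
  proof
    show "us ! k * x * a * us ! Suc k - us ! k \<in> M"
      using left_ideal_mult[OF li x, of "us ! k"] by (simp add: right_diff_distrib mult.assoc)
    fix j assume j: "Suc k < j" "j < length us"
    then have "us ! j = drop (Suc (Suc k)) us ! (j - Suc (Suc k))"
      using le_add_diff_inverse[of "Suc (Suc k)" j] nth_drop[of "Suc (Suc k)" us "j - Suc (Suc k)"]
      by (simp only: Suc_le_eq)
    moreover have "j - Suc (Suc k) < length (drop (Suc (Suc k)) us)" using j by simp
    ultimately have "us ! j \<in> set (drop (Suc (Suc k)) us)" by (metis nth_mem)
    then show "us ! k * x * a * us ! j \<in> M"
      using a(1) left_ideal_mult[OF li, of "a * us ! j" "us ! k * x"] by (simp add: mult.assoc)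
  qed
qed

section \<open>Multilinear polynomials\<close>

definition arrangements :: "nat \<Rightarrow> nat list set" where
  "arrangements d = {is. distinct is \<and> set is = {..<d}}"

text \<open>
  Every multilinear polynomial in \<open>d\<close> variables is of this form: its monomials are the arrangements of
  the variables, and \<open>\<alpha>\<close> gives the coefficients.
\<close>

definition multilinear :: "nat \<Rightarrow> (nat list \<Rightarrow> complex) \<Rightarrow> (nat \<Rightarrow> 'a) \<Rightarrow> 'a::unital_cstar_algebra" where
  "multilinear d \<alpha> x = (\<Sum>is\<in>arrangements d. \<alpha> is *\<^sub>C prod_list (map x is))"

lemma finite_arrangements [simp]: "finite (arrangements d)"
  unfolding arrangements_def
  by (rule finite_subset[OF _ finite_subset_distinct[of "{..<d}"]]) auto

lemma upt_in_arrangements: "[0..<d] \<in> arrangements d"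
  by (auto simp: arrangements_def)

text \<open>
  The factors act on \<open>u b\<close> from right to left. The factor with index \<open>b - 1\<close> moves it to \<open>u (b - 1)\<close>,
  and those with smaller index kill it; a word that survives
  this repeats it with \<open>b - 1\<close> for \<open>b\<close>, since the factor just used does not occur again. So the
  indices of a surviving word increase.
\<close>

lemma shift_word:
  fixes M :: "'a::unital_cstar_algebra set"
  assumes li: "left_ideal M"
    and shift: "\<And>k. k < m \<Longrightarrow> z k * u (Suc k) - u k \<in> M"
    and kill: "\<And>k j. Suc k < j \<Longrightarrow> j \<le> m \<Longrightarrow> z k * u j \<in> M"
  shows "distinct is \<Longrightarrow> set is = {a..<b} \<Longrightarrow> a \<le> b \<Longrightarrow> b \<le> m \<Longrightarrow>
    prod_list (map z is) * u b - (if is = [a..<b] then u a else 0) \<in> M"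
proof (induction "is" arbitrary: b rule: rev_induct)
  case Nil
  then have "a = b" by auto
  then show ?case by (simp add: left_ideal_zero[OF li])
next
  case (snoc k js)
  have k: "k \<in> {a..<b}" using snoc.prems(2) by auto
  show ?case
  proof (cases "b = Suc k")
    case True
    have "set js = {a..<b} - {k}" using snoc.prems(1,2) by auto
    also have "\<dots> = {a..<k}" unfolding True by auto
    finally have js: "set js = {a..<k}" .
    have "prod_list (map z js) * u k - (if js = [a..<k] then u a else 0) \<in> M"
      using snoc.IH[OF _ js] snoc.prems k True by simp
    moreover have "prod_list (map z js) * (z k * u b - u k) \<in> M"
      using left_ideal_mult[OF li shift] snoc.prems(4) True by simp
    moreover have "js @ [k] = [a..<b] \<longleftrightarrow> js = [a..<k]" using True k by simp
    ultimately show ?thesis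
      using left_ideal_add[OF li, of "prod_list (map z js) * (z k * u b - u k)"
          "prod_list (map z js) * u k - (if js = [a..<k] then u a else 0)"]
      by (simp add: right_diff_distrib mult.assoc)
  next
    case False
    then have "Suc k < b" using k by simp
    from left_ideal_mult[OF li kill[OF this snoc.prems(4)], of "prod_list (map z js)"]
    have "prod_list (map z js) * (z k * u b) \<in> M" .
    moreover have "js @ [k] \<noteq> [a..<b]"
    proof
      assume eq: "js @ [k] = [a..<b]"
      have "k = last (js @ [k])" by simp
      also have "\<dots> = b - 1" unfolding eq using k by (intro last_upt) simp
      finally show False using \<open>Suc k < b\<close> by simp
    qed
    ultimately show ?thesis by (simp add: mult.assoc)
  qed
qed

lemma multilinear_shift:
  fixes M :: "'a::unital_cstar_algebra set"
  assumes li: "left_ideal M"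
    and shift: "\<And>k. k < m \<Longrightarrow> z k * u (Suc k) - u k \<in> M"
    and kill: "\<And>k j. Suc k < j \<Longrightarrow> j \<le> m \<Longrightarrow> z k * u j \<in> M"
    and am: "a + d \<le> m"
  shows "multilinear d \<alpha> (\<lambda>i. z (a + i)) * u (a + d) - \<alpha> [0..<d] *\<^sub>C u a \<in> M"
proof -
  have word: "prod_list (map (\<lambda>i. z (a + i)) is) * u (a + d) - (if is = [0..<d] then u a else 0) \<in> M"
    if "is \<in> arrangements d" for "is"
  proof -
    have "prod_list (map z (map ((+) a) is)) * u (a + d)
        - (if map ((+) a) is = [a..<a + d] then u a else 0) \<in> M"
    proof (rule shift_word[where z = z and u = u and m = m, OF li shift kill])
      show "distinct (map ((+) a) is)" using that by (simp add: arrangements_def distinct_map)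
      have "set (map ((+) a) is) = (+) a ` {0..<d}"
        using that by (simp add: arrangements_def atLeast0LessThan)
      then show "set (map ((+) a) is) = {a..<a + d}" by (simp only: image_add_atLeastLessThan) (simp add: add.commute)
    qed (use am in auto)
    moreover have "map ((+) a) is = [a..<a + d] \<longleftrightarrow> is = [0..<d]"
    proof -
      have "[a..<a + d] = map ((+) a) [0..<d]"
        using map_add_upt[of a d] by (simp add: add.commute[of _ a])
      then show ?thesis by (simp add: inj_map_eq_map)
    qed
    ultimately show ?thesis by (simp add: comp_def)
  qed
  have "(\<Sum>is\<in>arrangements d. \<alpha> is *\<^sub>C
      (prod_list (map (\<lambda>i. z (a + i)) is) * u (a + d) - (if is = [0..<d] then u a else 0))) \<in> M"
    by (intro left_ideal_sum[OF li] left_ideal_scaleC[OF li] word)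
  moreover have "(\<Sum>is\<in>arrangements d. \<alpha> is *\<^sub>C (if is = [0..<d] then u a else 0)) = \<alpha> [0..<d] *\<^sub>C u a"
    by (simp add: if_distrib[of "\<lambda>v. _ *\<^sub>C v"] upt_in_arrangements cong: if_cong)
  ultimately show ?thesis
    by (simp add: multilinear_def scaleC_diff_right sum_subtractf sum_distrib_right mult_scaleC_left)
qed

text \<open>
  As \<open>d\<close> is positive, every monomial ends in some variable, which kills \<open>v\<close>.
\<close>

lemma multilinear_kill:
  fixes M :: "'a::unital_cstar_algebra set"
  assumes li: "left_ideal M" and d: "0 < d" and kill: "\<And>i. i < d \<Longrightarrow> x i * v \<in> M"
  shows "multilinear d \<alpha> x * v \<in> M"
proof -
  have "prod_list (map x is) * v \<in> M" if "is \<in> arrangements d" for "is"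
  proof (cases "is" rule: rev_cases)
    case Nil
    then show ?thesis using that d by (auto simp: arrangements_def)
  next
    case (snoc js k)
    then have "k < d" using that by (auto simp: arrangements_def)
    then show ?thesis using snoc left_ideal_mult[OF li kill] by (simp add: mult.assoc)
  qed
  then show ?thesis
    unfolding multilinear_def sum_distrib_right mult_scaleC_left
    by (intro left_ideal_sum[OF li] left_ideal_scaleC[OF li])
qed

text \<open>
  Suppose a maximal left ideal \<open>M\<close> contains \<open>I\<close>. A chain \<open>u\<^sub>0, \<dots>, u\<^bsub>2d\<^esub>\<close> of independent vectors exists, and
  factors that shift it are assigned to the variables: the first \<open>d\<close> factors to \<open>x\<close>, the last \<open>d\<close>
  to \<open>y\<close>. With \<open>c = \<alpha> [0..<d]\<close>, the product \<open>g(x) g(y)\<close> moves \<open>u\<^bsub>2d\<^esub>\<close> to \<open>c\<^sup>2 u\<^sub>0\<close>, while \<open>g(x)\<close> kills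
  \<open>u\<^bsub>2d\<^esub>\<close>. So the commutator does not act as zero on \<open>A/M\<close>.
\<close>

theorem commutators_of_multilinear_values_generate:
  fixes I :: "'a::unital_cstar_algebra set"
  assumes no_trace: "\<nexists>\<tau> :: 'a \<Rightarrow> complex. (\<forall>x y. \<tau> (x + y) = \<tau> x + \<tau> y) \<and>
      (\<forall>x y. \<tau> (x * y) = \<tau> (y * x)) \<and> \<tau> 1 \<noteq> 0"
    and d: "0 < d" and \<alpha>: "\<alpha> [0..<d] \<noteq> 0"
    and I: "left_ideal I" "\<And>a b. a \<in> I \<Longrightarrow> a * b \<in> I"
    and comm: "\<And>x y. multilinear d \<alpha> x * multilinear d \<alpha> y
      - multilinear d \<alpha> y * multilinear d \<alpha> x \<in> I"
  shows "1 \<in> I"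
proof (rule ccontr)
  assume "1 \<notin> I"
  then obtain M where M: "maximal_left_ideal M" and IM: "I \<subseteq> M"
    using exists_maximal_left_ideal[OF I(1)] by blast
  note li = maximal_left_idealD(1)[OF M]
  obtain us where us: "length us = Suc (2 * d)" "independent_modulo M us"
    using long_independent_modulo[OF M no_trace] by blast
  define u where "u i = us ! i" for i
  have "\<exists>z. z * u (Suc k) - u k \<in> M \<and> (\<forall>j. Suc k < j \<longrightarrow> j \<le> 2 * d \<longrightarrow> z * u j \<in> M)"
    if "k < 2 * d" for k
  proof -
    have "Suc k < length us" using that us(1) by simp
    then obtain z where "z * us ! Suc k - us ! k \<in> M"
      "\<And>j. Suc k < j \<Longrightarrow> j < length us \<Longrightarrow> z * us ! j \<in> M"
      using shift_elements[OF M us(2)] by blast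
    then show ?thesis unfolding u_def us(1) by (intro exI[of _ z]) simp
  qed
  then obtain z where z: "\<And>k. k < 2 * d \<Longrightarrow> z k * u (Suc k) - u k \<in> M"
    "\<And>k j. k < 2 * d \<Longrightarrow> Suc k < j \<Longrightarrow> j \<le> 2 * d \<Longrightarrow> z k * u j \<in> M" by metis
  define x y where "x i = z i" and "y i = z (d + i)" for i
  define g :: "(nat \<Rightarrow> 'a) \<Rightarrow> 'a" where "g = multilinear d \<alpha>"
  define c where "c = \<alpha> [0..<d]"
  have kill: "z k * u j \<in> M" if "Suc k < j" "j \<le> 2 * d" for k j using z(2)[of k j] that by simp
  have gx: "g x * u d - c *\<^sub>C u 0 \<in> M"
    using multilinear_shift[where z = z and u = u and m = "2 * d" and a = 0 and d = d, OF li z(1) kill] by (simp add: g_def x_def[abs_def] c_def)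
  have gy: "g y * u (2 * d) - c *\<^sub>C u d \<in> M"
    using multilinear_shift[where z = z and u = u and m = "2 * d" and a = d and d = d, OF li z(1) kill]
    by (simp add: g_def y_def[abs_def] c_def mult_2)
  have gx0: "g x * u (2 * d) \<in> M"
    unfolding g_def by (rule multilinear_kill[OF li d]) (auto simp: x_def intro!: kill)
  have "g x * (g y * u (2 * d) - c *\<^sub>C u d) + c *\<^sub>C (g x * u d - c *\<^sub>C u 0) - g y * (g x * u (2 * d)) \<in> M"
    by (intro left_ideal_diff[OF li] left_ideal_add[OF li] left_ideal_mult[OF li gy]
        left_ideal_scaleC[OF li gx] left_ideal_mult[OF li gx0])
  then have "(g x * g y - g y * g x) * u (2 * d) - (c * c) *\<^sub>C u 0 \<in> M"
    by (simp add: algebra_simps mult_scaleC_right scaleC_diff_right scaleC_scaleC)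
  moreover have "(g x * g y - g y * g x) * u (2 * d) \<in> M"
    using I(2)[OF comm] IM by (auto simp: g_def)
  ultimately have "(c * c) *\<^sub>C u 0 \<in> M" using left_ideal_cong[OF li] by blast
  from left_ideal_scaleC[OF li this, of "1 / (c * c)"]
  have "u 0 \<in> M" using \<alpha> by (simp add: scaleC_scaleC c_def)
  moreover have "u 0 \<notin> modulo_span M (drop 1 us)"
    using independent_modulo_nth[OF us(2), of 0] us(1) by (simp add: u_def)
  ultimately show False using modulo_span_superset by blast
qed

section \<open>Linear combinations of bounded length\<close>

text \<open>
  Keeping track of the number of terms, instead of using the linear span, is what yields one \<open>N\<close> for all
  elements in the end.
\<close>

inductive combination :: "'a::unital_cstar_algebra set \<Rightarrow> nat \<Rightarrow> 'a \<Rightarrow> bool" for S where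
  zero: "combination S 0 0"
| step: "combination S n x \<Longrightarrow> v \<in> S \<Longrightarrow> combination S (Suc n) (x + c *\<^sub>C v)"

lemma combination_add:
  assumes "combination S m x" "combination S n y"
  shows "combination S (m + n) (x + y)"
  using assms(2)
proof induction
  case zero
  then show ?case using assms(1) by simp
next
  case (step n y v c)
  then show ?case using combination.step[of S "m + n" "x + y" v c] by (simp add: add.assoc)
qed

lemma combination_scaleC: "combination S n x \<Longrightarrow> combination S n (c *\<^sub>C x)"
proof (induction rule: combination.induct)
  case zero
  then show ?case using combination.zero by simp
next
  case (step n x v d)
  then show ?case using combination.step[of S n "c *\<^sub>C x" v "c * d"]
    by (simp add: scaleC_add_right scaleC_scaleC)
qed

lemma combination_minus: "combination S n x \<Longrightarrow> combination S n (- x)"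
  using combination_scaleC[of S n x "-1"] by simp

lemma combination_single: "v \<in> S \<Longrightarrow> combination S 1 v"
  using combination.step[OF combination.zero, of v S 1] by simp

lemma combination_sum:
  assumes "\<And>i. i \<in> I \<Longrightarrow> combination S n (x i)" "finite I"
  shows "combination S (card I * n) (\<Sum>i\<in>I. x i)"
  using assms(2,1) by (induction I) (auto simp: combination.zero intro: combination_add)

lemma combination_sum_list:
  assumes "\<And>i. i \<in> set is \<Longrightarrow> combination S n (x i)"
  shows "combination S (length is * n) (\<Sum>i\<leftarrow>is. x i)"
  using assms by (induction "is") (auto simp: combination.zero intro: combination_add)

lemma combination_linear:
  assumes "combination S n x" and img: "\<And>v. v \<in> S \<Longrightarrow> combination T m (h v)"
    and add: "\<And>x y. h (x + y) = h x + h y" and scale: "\<And>c x. h (c *\<^sub>C x) = c *\<^sub>C h x"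
  shows "combination T (n * m) (h x)"
  using assms(1)
proof induction
  case zero
  then show ?case using scale[of 0 0] by (simp add: combination.zero)
next
  case (step n x v c)
  from combination_add[OF combination_scaleC[OF img[OF step.hyps(2)], of c] step.IH]
  show ?case by (simp add: add scale add.commute)
qed

lemma combination_range_indexed:
  assumes "combination (range g) n x"
  shows "\<exists>(c :: nat \<Rightarrow> complex) a. x = (\<Sum>i<n. c i *\<^sub>C g (a i))"
  using assms
proof induction
  case (step n x v d)
  then obtain c a b where "x = (\<Sum>i<n. c i *\<^sub>C g (a i))" "v = g b" by auto
  then show ?case
    by (intro exI[of _ "c(n := d)"] exI[of _ "a(n := b)"]) simp
qed simp

section \<open>Multilinear values span a Lie ideal\<close>

lemma commutator_prod_list:
  fixes a :: "'a::ring_1"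
  assumes "distinct is"
  shows "a * prod_list (map x is) - prod_list (map x is) * a
    = (\<Sum>j\<in>set is. prod_list (map (x(j := a * x j - x j * a)) is))"
  using assms
proof (induction "is")
  case (Cons i js)
  define x' where "x' j = x(j := a * x j - x j * a)" for j
  have IH: "a * prod_list (map x js) - prod_list (map x js) * a = (\<Sum>j\<in>set js. prod_list (map (x' j) js))"
    unfolding x'_def by (rule Cons.IH) (use Cons.prems in simp)
  have "map (x' i) js = map x js" using Cons.prems by (auto simp: x'_def)
  then have "prod_list (map (x' i) js) = prod_list (map x js)" by (simp only:)
  moreover have "x' j i = x i" if "j \<in> set js" for j using Cons.prems that by (auto simp: x'_def)
  ultimately have "(\<Sum>j\<in>set (i # js). prod_list (map (x' j) (i # js)))
      = x' i i * prod_list (map x js) + x i * (\<Sum>j\<in>set js. prod_list (map (x' j) js))"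
    using Cons.prems by (simp add: sum_distrib_left)
  also have "\<dots> = a * prod_list (map x (i # js)) - prod_list (map x (i # js)) * a"
    unfolding IH[symmetric] by (simp add: x'_def algebra_simps)
  finally show ?case by (simp only: x'_def)
qed simp

text \<open>
  The commutator with \<open>a\<close> is a derivation, and a multilinear polynomial is differentiated one variable at
  a time; so its values span a Lie ideal.
\<close>

lemma commutator_multilinear:
  "a * multilinear d \<alpha> x - multilinear d \<alpha> x * a
    = (\<Sum>j<d. multilinear d \<alpha> (x(j := a * x j - x j * a)))"
proof -
  have "a * multilinear d \<alpha> x - multilinear d \<alpha> x * a
      = (\<Sum>is\<in>arrangements d. \<alpha> is *\<^sub>C (a * prod_list (map x is) - prod_list (map x is) * a))"
    by (simp add: multilinear_def sum_distrib_left sum_distrib_right mult_scaleC_left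
        mult_scaleC_right scaleC_diff_right sum_subtractf)
  also have "\<dots> = (\<Sum>is\<in>arrangements d. \<Sum>j<d.
      \<alpha> is *\<^sub>C prod_list (map (x(j := a * x j - x j * a)) is))"
    by (rule sum.cong) (auto simp: arrangements_def commutator_prod_list scaleC_sum_right)
  also have "\<dots> = (\<Sum>j<d. multilinear d \<alpha> (x(j := a * x j - x j * a)))"
    unfolding multilinear_def by (rule sum.swap)
  finally show ?thesis .
qed

text \<open>
  For a Lie ideal \<open>L\<close> and the two-sided ideal \<open>J\<close> generated by \<open>[L, L]\<close>, the inclusion of \<open>[A, J]\<close> in \<open>L\<close>,
  with the number of terms counted.
\<close>

lemma commutator_in_bounded_lie_ideal:
  fixes S :: "'a::unital_cstar_algebra set"
  assumes lie: "\<And>a v. v \<in> S \<Longrightarrow> combination S d (a * v - v * a)"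
    and l: "l \<in> S" and m: "m \<in> S"
  shows "combination S (2 * (d * d + d + d * d))
    (c * (p * (l * m - m * l) * q) - p * (l * m - m * l) * q * c)"
proof -
  define K where "K = d * d + d + d * d"
  have lie': "combination S (n * d) (a * v - v * a)" if "combination S n v" for a v n
    using that lie
    by (rule combination_linear) (simp_all add: algebra_simps mult_scaleC_left mult_scaleC_right scaleC_diff_right)
  have lie'': "combination S (n * d) (v * a - a * v)" if "combination S n v" for a v n
    using combination_minus[OF lie'[OF that, of a]] by simp
  have right: "combination S K (c * ((l * m - m * l) * q) - (l * m - m * l) * q * c)"
    for c q
  proof -
    \<comment> \<open>With \<open>l' = [l, q]\<close>, the identity
      \<open>[c, [l, m] q] = [c, [l, m q]] + [m, l' c] + [l', c m]\<close> follows from \<open>[l, m] q = [l, m q] - m l'\<close>.\<close>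
    have "combination S d (l * y - y * l)" for y using combination_minus[OF lie[OF l, of y]] by simp
    then have "combination S (d * d + d + d * d)
      ((c * (l * (m * q) - m * q * l) - (l * (m * q) - m * q * l) * c)
        + (m * ((l * q - q * l) * c) - ((l * q - q * l) * c) * m)
        + ((l * q - q * l) * (c * m) - c * m * (l * q - q * l)))"
      using lie''[OF combination_single[OF m], of "(l * q - q * l) * c"]
      by (intro combination_add lie' lie'') simp_all
    then show ?thesis by (simp add: K_def algebra_simps)
  qed
  \<comment> \<open>The factor \<open>p\<close> on the left is moved by \<open>[c, p e] = [c p, e] - [p, e c]\<close>, here with
    \<open>e = [l, m] q\<close>.\<close>
  have "combination S (K + K)
     ((c * p * ((l * m - m * l) * q) - (l * m - m * l) * q * (c * p))
        + - (p * ((l * m - m * l) * (q * c)) - (l * m - m * l) * (q * c) * p))"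
    by (intro combination_add combination_minus right)
  then show ?thesis unfolding K_def[symmetric] mult_2[of K] by (simp add: algebra_simps)
qed

theorem combination_of_multilinear_values:
  assumes no_trace: "\<nexists>\<tau> :: 'a::unital_cstar_algebra \<Rightarrow> complex. bounded_trace \<tau>"
    and d: "0 < d" and \<alpha>: "\<alpha> [0..<d] \<noteq> 0"
  obtains N where "\<And>x :: 'a. combination (range (multilinear d \<alpha>)) N x"
proof -
  obtain ys :: "'a list" where ys: "\<forall>x. \<exists>a. x = (\<Sum>y\<leftarrow>ys. star y * (y * a) - (y * a) * star y)"
    by (rule all_sums_of_commutators[OF no_trace])
  have no_alg_trace: "\<nexists>\<tau> :: 'a \<Rightarrow> complex. (\<forall>x y. \<tau> (x + y) = \<tau> x + \<tau> y) \<and>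
      (\<forall>x y. \<tau> (x * y) = \<tau> (y * x)) \<and> \<tau> 1 \<noteq> 0"
  proof safe
    fix \<tau> :: "'a \<Rightarrow> complex"
    assume add: "\<forall>x y. \<tau> (x + y) = \<tau> x + \<tau> y" and comm: "\<forall>x y. \<tau> (x * y) = \<tau> (y * x)"
      and one: "\<tau> 1 \<noteq> 0"
    have zero: "\<tau> 0 = 0" using add[rule_format, of 0 0] by simp
    have diff: "\<tau> (x - y) = \<tau> x - \<tau> y" for x y using add[rule_format, of "x - y" y] by simp
    have "\<tau> (\<Sum>y\<leftarrow>zs. star y * (y * a) - (y * a) * star y) = 0" for zs a
    proof (induction zs)
      case (Cons y zs)
      have "\<tau> (star y * (y * a) - y * a * star y) = 0" by (simp only: diff comm[rule_format, of "star y"] diff_self)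
      then show ?case using Cons by (simp add: add)
    qed (simp add: zero)
    then show False using ys one by metis
  qed
  define S :: "'a set" where "S = range (multilinear d \<alpha>)"
  have lie: "combination S d (a * v - v * a)" if vS: "v \<in> S" for a v
  proof -
    obtain x where v: "v = multilinear d \<alpha> x" using vS by (auto simp: S_def)
    have "combination S (card {..<d} * 1) (\<Sum>j<d. multilinear d \<alpha> (x(j := a * x j - x j * a)))"
      by (rule combination_sum, rule combination_single) (simp_all add: S_def)
    then show ?thesis by (simp add: v commutator_multilinear)
  qed
  define T where "T = S \<times> S \<times> (UNIV :: ('a \<times> 'a) set)"
  define e where "e = (\<lambda>(l, m, p, q). p * (l * m - m * l) * q :: 'a)"
  \<comment> \<open>The two-sided ideal generated by the commutators of elements of \<open>S\<close>; an expression of \<open>1\<close> in it fixes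
    the number of terms for all elements.\<close>
  define I where "I = {(\<Sum>t\<leftarrow>ts. e t) |ts. set ts \<subseteq> T}"
  have li: "left_ideal I" unfolding left_ideal_def
  proof (intro conjI ballI allI)
    show "0 \<in> I" unfolding I_def by (intro CollectI exI[of _ "[]"]) simp
    fix x assume "x \<in> I"
    then obtain ts where ts: "x = (\<Sum>t\<leftarrow>ts. e t)" "set ts \<subseteq> T" by (auto simp: I_def)
    show "a * x \<in> I" for a
    proof -
      have "a * x = (\<Sum>t\<leftarrow>map (\<lambda>(l, m, p, q). (l, m, a * p, q)) ts. e t)"
        unfolding ts(1) by (induction ts) (auto simp: e_def distrib_left mult.assoc)
      moreover have "set (map (\<lambda>(l, m, p, q). (l, m, a * p, q)) ts) \<subseteq> T"
        using ts(2) by (auto simp: T_def)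
      ultimately show ?thesis unfolding I_def by blast
    qed
    fix y assume "y \<in> I"
    then obtain us where "y = (\<Sum>t\<leftarrow>us. e t)" "set us \<subseteq> T" by (auto simp: I_def)
    then show "x + y \<in> I" unfolding I_def
      using ts by (intro CollectI exI[of _ "ts @ us"]) simp
  qed
  have right: "x * a \<in> I" if xI: "x \<in> I" for x a
  proof -
    obtain ts where ts: "x = (\<Sum>t\<leftarrow>ts. e t)" "set ts \<subseteq> T" using xI by (auto simp: I_def)
    have "x * a = (\<Sum>t\<leftarrow>map (\<lambda>(l, m, p, q). (l, m, p, q * a)) ts. e t)"
      unfolding ts(1) by (induction ts) (auto simp: e_def distrib_right mult.assoc)
    moreover have "set (map (\<lambda>(l, m, p, q). (l, m, p, q * a)) ts) \<subseteq> T"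
      using ts(2) by (auto simp: T_def)
    ultimately show ?thesis unfolding I_def by blast
  qed
  have comm: "multilinear d \<alpha> x * multilinear d \<alpha> y - multilinear d \<alpha> y * multilinear d \<alpha> x \<in> I"
    for x y :: "nat \<Rightarrow> 'a"
    unfolding I_def
    by (intro CollectI exI[of _ "[(multilinear d \<alpha> x, multilinear d \<alpha> y, 1, 1)]"])
      (simp add: e_def T_def S_def)
  have "1 \<in> I"
    by (rule commutators_of_multilinear_values_generate[OF no_alg_trace d \<alpha> li right comm])
  then obtain ts where ts: "1 = (\<Sum>t\<leftarrow>ts. e t)" "set ts \<subseteq> T" by (auto simp: I_def)
  define K where "K = length ts * (2 * (d * d + d + d * d))"
  have comm_K: "combination S K (c * a - a * c)" for c a
  proof -
    have expand: "c * ((\<Sum>t\<leftarrow>zs. e t) * a) - (\<Sum>t\<leftarrow>zs. e t) * a * c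
        = (\<Sum>t\<leftarrow>zs. c * (e t * a) - e t * a * c)" for zs
      by (induction zs) (auto simp: algebra_simps)
    have "a = (\<Sum>t\<leftarrow>ts. e t) * a" by (simp flip: ts(1))
    then have "c * a - a * c = c * ((\<Sum>t\<leftarrow>ts. e t) * a) - (\<Sum>t\<leftarrow>ts. e t) * a * c" by simp
    also have "\<dots> = (\<Sum>t\<leftarrow>ts. c * (e t * a) - e t * a * c)" by (rule expand)
    also have "combination S K \<dots>" unfolding K_def
    proof (rule combination_sum_list)
      fix t assume "t \<in> set ts"
      then obtain l m p q where "t = (l, m, p, q)" "l \<in> S" "m \<in> S" using ts(2) by (auto simp: T_def)
      then show "combination S (2 * (d * d + d + d * d)) (c * (e t * a) - e t * a * c)"
        using commutator_in_bounded_lie_ideal[OF lie, of l m c p "q * a"]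
        by (simp add: e_def mult.assoc)
    qed
    finally show ?thesis .
  qed
  have "combination S (length ys * K) x" for x
  proof -
    obtain a where "x = (\<Sum>y\<leftarrow>ys. star y * (y * a) - (y * a) * star y)" using ys by blast
    then show ?thesis by (simp only:) (rule combination_sum_list[OF comm_K])
  qed
  then show ?thesis unfolding S_def by (rule that)
qed

section \<open>Linearization\<close>

text \<open>
  Distributivity, indexed by words: a word over the index set \<open>T\<close> contributes to the word \<open>w\<close> of variables
  if \<open>h\<close> maps it to \<open>w\<close>.
\<close>

lemma prod_list_sum_expand:
  fixes x :: "nat \<Rightarrow> 'a::ring_1"
  assumes T: "finite T"
  shows "prod_list (map (\<lambda>v. \<Sum>i | i \<in> T \<and> h i = v. x i) w)
    = (\<Sum>is | set is \<subseteq> T \<and> map h is = w. prod_list (map x is))"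
proof (induction w)
  case Nil
  have "{is. set is \<subseteq> T \<and> map h is = []} = {[]}" by auto
  then show ?case by simp
next
  case (Cons v w)
  have fin: "finite {is. set is \<subseteq> T \<and> map h is = w}" for w
    by (rule finite_subset[OF _ finite_lists_length_eq[OF T, of "length w"]]) auto
  have eq: "{is. set is \<subseteq> T \<and> map h is = v # w}
      = (\<lambda>(i, is). i # is) ` ({i. i \<in> T \<and> h i = v} \<times> {is. set is \<subseteq> T \<and> map h is = w})"
    by (auto simp: map_eq_Cons_conv image_iff)
  have inj: "inj_on (\<lambda>(i, is). i # is) X" for X :: "(nat \<times> nat list) set"
    by (auto simp: inj_on_def)
  show ?case
    unfolding eq sum.reindex[OF inj]
    by (simp add: Cons sum_product sum.cartesian_product split_def)
qed

lemma alternating_sum_between: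
  assumes "finite A" "R \<subseteq> A"
  shows "(\<Sum>T | T \<in> Pow A \<and> R \<subseteq> T. (-1) ^ card T) = (if R = A then (-1) ^ card A else (0::'b::ring_1))"
proof (cases "R = A")
  case True
  then have "{T. T \<in> Pow A \<and> R \<subseteq> T} = {A}" by auto
  then show ?thesis using True by simp
next
  case False
  with assms have "R \<subset> A" by blast
  from card_subsupersets_even_odd[OF assms(1) this] False show ?thesis
    using sum_alternating_cancels[of "{T. T \<in> Pow A \<and> R \<subseteq> T}" card] assms(1)
    by (simp add: conj_assoc)
qed

text \<open>
  Let \<open>w0\<close> be a word of length \<open>d\<close>. The variable \<open>v\<close> is replaced by the sum of those \<open>x i\<close>, \<open>i \<in> T\<close>, for
  which \<open>v\<close> is the letter of \<open>w0\<close> at position \<open>i\<close>. Expanding \<open>f\<close> gives words in the \<open>x i\<close>, and the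
  alternating sum over \<open>T\<close> retains those in which all \<open>d\<close> indices occur. As no word of \<open>f\<close> is longer
  than \<open>d\<close>, each index then occurs exactly once. The coefficient of the word \<open>x 0 \<cdots> x (d - 1)\<close> is
  that of \<open>w0\<close> in \<open>f\<close>.
\<close>

lemma linearization:
  fixes f :: "'v ncpoly" and x :: "nat \<Rightarrow> 'a::unital_cstar_algebra"
  assumes d: "length w0 = d" and max: "\<And>w. w \<in> Poly_Mapping.keys f \<Longrightarrow> length w \<le> d"
  shows "(\<Sum>T\<in>Pow {..<d}. (-1) ^ card T *\<^sub>C nceval f (\<lambda>v. \<Sum>i | i \<in> T \<and> w0 ! i = v. x i))
    = (-1) ^ d *\<^sub>C multilinear d (\<lambda>is. Poly_Mapping.lookup f (map ((!) w0) is)) x"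
proof -
  define F where "F is = Poly_Mapping.lookup f (map ((!) w0) is) *\<^sub>C prod_list (map x is)" for "is"
  define B where "B = {is. set is \<subseteq> {..<d} \<and> map ((!) w0) is \<in> Poly_Mapping.keys f}"
  have finB: "finite B"
    by (rule finite_subset[OF _ finite_lists_length_le[of "{..<d}" d]])
      (use max in \<open>force simp: B_def\<close>)+
  have eval: "nceval f (\<lambda>v. \<Sum>i | i \<in> T \<and> w0 ! i = v. x i) = (\<Sum>is | is \<in> B \<and> set is \<subseteq> T. F is)"
    if T: "T \<in> Pow {..<d}" for T
  proof -
    have "finite T" using T finite_subset by auto
    then have "nceval f (\<lambda>v. \<Sum>i | i \<in> T \<and> w0 ! i = v. x i)
        = (\<Sum>w\<in>Poly_Mapping.keys f. \<Sum>is | set is \<subseteq> T \<and> map ((!) w0) is = w. F is)"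
      unfolding nceval_def
      by (intro sum.cong refl) (auto simp: prod_list_sum_expand scaleC_sum_right F_def intro!: sum.cong)
    also have "\<dots> = (\<Sum>w\<in>Poly_Mapping.keys f.
        \<Sum>is | is \<in> {is \<in> B. set is \<subseteq> T} \<and> map ((!) w0) is = w. F is)"
      using T by (intro sum.cong refl) (auto simp: B_def)
    also have "\<dots> = (\<Sum>is | is \<in> B \<and> set is \<subseteq> T. F is)"
      proof (rule sum.group)
      show "finite {is \<in> B. set is \<subseteq> T}" using finB by simp
    qed (auto simp: B_def)
    finally show ?thesis .
  qed
  have "(\<Sum>T\<in>Pow {..<d}. (-1) ^ card T *\<^sub>C nceval f (\<lambda>v. \<Sum>i | i \<in> T \<and> w0 ! i = v. x i))
      = (\<Sum>T\<in>Pow {..<d}. \<Sum>is | is \<in> B \<and> set is \<subseteq> T. (-1) ^ card T *\<^sub>C F is)"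
    by (intro sum.cong refl) (simp add: eval scaleC_sum_right)
  also have "\<dots> = (\<Sum>is\<in>B. \<Sum>T | T \<in> Pow {..<d} \<and> set is \<subseteq> T. (-1) ^ card T *\<^sub>C F is)"
    by (rule sum.swap_restrict) (simp_all add: finB)
  also have "\<dots> = (\<Sum>is\<in>B. if set is = {..<d} then (-1) ^ d *\<^sub>C F is else 0)"
    by (intro sum.cong refl)
      (auto simp: B_def alternating_sum_between simp del: Pow_iff simp flip: scaleC_sum_left)
  also have "\<dots> = (\<Sum>is | is \<in> B \<and> set is = {..<d}. (-1) ^ d *\<^sub>C F is)"
    using finB by (simp add: sum.inter_filter)
  also have "\<dots> = (\<Sum>is\<in>arrangements d. (-1) ^ d *\<^sub>C F is)"
  proof (rule sum.mono_neutral_left)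
    show "{is. is \<in> B \<and> set is = {..<d}} \<subseteq> arrangements d"
    proof
      fix "is" assume "is \<in> {is. is \<in> B \<and> set is = {..<d}}"
      then have "set is = {..<d}" "length is \<le> d" using max by (force simp: B_def)+
      then show "is \<in> arrangements d"
        using card_distinct[of "is"] card_length[of "is"] by (simp add: arrangements_def)
    qed
    show "\<forall>is\<in>arrangements d - {is. is \<in> B \<and> set is = {..<d}}. (-1) ^ d *\<^sub>C F is = 0"
    proof
      fix "is" assume "is \<in> arrangements d - {is. is \<in> B \<and> set is = {..<d}}"
      then have "map ((!) w0) is \<notin> Poly_Mapping.keys f" unfolding arrangements_def B_def by blast
      then have "Poly_Mapping.lookup f (map ((!) w0) is) = 0" by (simp only: in_keys_iff not_not)
      then show "(-1) ^ d *\<^sub>C F is = 0" by (simp only: F_def scaleC_zero_left scaleC_zero_right)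
    qed
  qed simp
  finally show ?thesis by (simp add: multilinear_def F_def scaleC_sum_right)
qed

theorem corollary3p10:
  fixes f :: "'v::finite ncpoly"
  assumes "\<nexists>\<tau> :: 'a::unital_cstar_algebra \<Rightarrow> complex. bounded_trace \<tau>"
    and "nonconstant f"
  shows "\<exists>N::nat. \<forall>x::'a. \<exists>(c :: nat \<Rightarrow> complex) (a :: nat \<Rightarrow> 'v \<Rightarrow> 'a).
           x = (\<Sum>i<N. c i *\<^sub>C nceval f (a i))"
proof -
  have "\<exists>w\<in>Poly_Mapping.keys f. w \<noteq> []"
  proof (rule ccontr)
    assume "\<not> (\<exists>w\<in>Poly_Mapping.keys f. w \<noteq> [])"
    then have "ncdegree_in v f = 0" for v
      unfolding ncdegree_in_def by (intro Max_eqI) auto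
    then show False using assms(2) by (simp add: nonconstant_def)
  qed
  then obtain w1 where w1: "w1 \<in> Poly_Mapping.keys f" "w1 \<noteq> []" by blast
  have "Max (length ` Poly_Mapping.keys f) \<in> length ` Poly_Mapping.keys f"
    using w1(1) by (intro Max_in) auto
  then obtain w0 where w0: "w0 \<in> Poly_Mapping.keys f"
    and len: "length w0 = Max (length ` Poly_Mapping.keys f)" by auto
  have max: "length w \<le> length w0" if "w \<in> Poly_Mapping.keys f" for w
    unfolding len using that by (intro Max_ge) auto
  define d where "d = length w0"
  have d: "0 < d" using max[OF w1(1)] w1(2) by (cases w0) (auto simp: d_def)
  define \<alpha> where "\<alpha> is = Poly_Mapping.lookup f (map ((!) w0) is)" for "is"
  have \<alpha>: "\<alpha> [0..<d] \<noteq> 0" using w0 by (simp add: \<alpha>_def d_def map_nth in_keys_iff)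
  obtain N where N: "\<And>x :: 'a. combination (range (multilinear d \<alpha>)) N x"
    using combination_of_multilinear_values[where \<alpha> = \<alpha>, OF assms(1) d \<alpha>] by blast
  define S :: "'a set" where "S = range (nceval f)"
  have vals: "combination S (card (Pow {..<d}) * 1) (multilinear d \<alpha> x)" for x :: "nat \<Rightarrow> 'a"
  proof -
    define y where "y T = (\<lambda>v. \<Sum>i | i \<in> T \<and> w0 ! i = v. x i)" for T
    have "(\<Sum>T\<in>Pow {..<d}. (-1) ^ card T *\<^sub>C nceval f (y T)) = (-1) ^ d *\<^sub>C multilinear d \<alpha> x"
      using linearization[OF d_def[symmetric] max[folded d_def], where x = x]
      by (simp add: \<alpha>_def[abs_def] y_def)
    moreover have "combination S (card (Pow {..<d}) * 1)
        (\<Sum>T\<in>Pow {..<d}. (-1) ^ card T *\<^sub>C nceval f (y T))"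
      by (rule combination_sum, rule combination_scaleC, rule combination_single)
        (simp_all add: S_def)
    ultimately have "combination S (card (Pow {..<d}) * 1) ((-1) ^ d *\<^sub>C (-1) ^ d *\<^sub>C multilinear d \<alpha> x)"
      by (intro combination_scaleC[of S _ "(-1) ^ d *\<^sub>C multilinear d \<alpha> x"]) (simp only:)
    then show ?thesis by (simp add: scaleC_scaleC)
  qed
  have "combination S (N * (card (Pow {..<d}) * 1)) x" for x
    using combination_linear[OF N[of x], of S "card (Pow {..<d}) * 1" "\<lambda>x. x"] vals by auto
  then show ?thesis unfolding S_def using combination_range_indexed by blast
qed

end
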